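(* Let $D$ be a graded-division algebra with abelian support over a field $\mathbb F$, and let $R=\mathcal M(D,\varphi_0,q,s,\underline d,\delta)$ and $R'=\mathcal M(D,\varphi_0',q',s',\underline d',\delta')$. The graded algebras with involution $R$ and $R'$ are equivalent if and only if $q'=q$, $s'=s$, and there exist an equivalence $\psi_0:D\to D$ of graded algebras and an element $c_0\in D^\times_{\mathrm{gr}}$ such that (i) $\varphi_0'=\mathrm{Int}(c_0)\circ\psi_0\varphi_0\psi_0^{-1}$, (ii) $\varphi_0'(c_0)=\delta\delta'c_0$, and (iii) there exist $c_1,\dots,c_q\in D^\times_{\mathrm{gr}}$ such that the $q$-tuple $(d_1',\dots,d_q')$ is a permutation of $(\tilde d_1,\dots,\tilde d_q)$ where $\tilde d_i:=c_0\,\psi_0\bigl(c_id_i\varphi_0(c_i)\bigr)$.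
   Context: All algebras are associative over an arbitrary field $\mathbb F$. A graded-division algebra is a unital graded algebra in which all nonzero homogeneous elements are invertible; $D^\times_{\mathrm{gr}}$ is the group of nonzero homogeneous elements and $\mathrm{Int}(d)(x)=dxd^{-1}$. An involution is an $\mathbb F$-linear antiautomorphism of order at most 2; degree-preserving means each homogeneous component is mapped to itself. An equivalence of graded algebras is an algebra isomorphism mapping each nonzero homogeneous component onto a homogeneous component; an equivalence of graded algebras with involution must in addition commute with the involutions. Construction of $\mathcal M$. Let $T$ be the support of $D$, $\varphi_0$ a degree-preserving involution on $D$, $q,s\ge0$ integers not both zero, $\delta\in\{\pm1\}$, $\underline d=(d_1,\dots,d_q)$ with $d_i\in D^\times_{\mathrm{gr}}$, $\varphi_0(d_i)=\delta d_i$, $t_i=\deg d_i$, $k=q+2s$. $\widetilde G(T,q,s,\underline t)$ is the quotient of $F\times T$, $F$ free abelian on $\tilde g_1,\dots,\tilde g_k$, by the relations $\tilde g_1^2t_1^{-1}=\dots=\tilde g_q^2t_q^{-1}=\tilde g_{q+1}\tilde g_{q+2}=\dots=\tilde g_{q+2s-1}\tilde g_{q+2s}$. $\mathcal M(D,\varphi_0,q,s,\underline d,\delta)$ is $M_k(D)=M_k(\mathbb F)\otimes D$ with grading by this group, $\deg(E_{ij}\otimes d)=\tilde g_i\tilde g_j^{-1}t$ for $0\ne d\in D_t$, and involution $X\mapsto\Phi^{-1}\varphi_0(X^T)\Phi$ ($\varphi_0$ applied entrywise), $\Phi=\mathrm{diag}\left(d_1,\dots,d_q,\begin{bmatrix}0&1\\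 \delta&0\end{bmatrix},\dots,\begin{bmatrix}0&1\\ \delta&0\end{bmatrix}\right)$ with $s$ blocks of size 2. The data $(\varphi_0',q',s',\underline d',\delta')$ satisfy the same requirements. *)

theory Defs
  imports
    Jordan_Normal_Form.Matrix
    "HOL-Algebra.QuotRing"
    "HOL-Algebra.Generated_Groups"
    "HOL-Algebra.Free_Abelian_Groups"
begin

text \<open>
  The algebra \<open>D\<close> is a type of class \<^class>\<open>ring_1\<close> with a scalar multiplication by the field
  \<open>'f\<close>, graded by a (possibly nonabelian) group \<open>G\<close>. Algebras whose carrier is not a whole type
  (matrix algebras of variable size) are records, so that both kinds can be compared.
\<close>

section \<open>Graded algebras\<close>

record ('f, 'a, 'g) graded_alg = "('f, 'a) module" +
  grading_group :: "'g monoid"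
  component :: "'g \<Rightarrow> 'a set"

record ('f, 'a, 'g) graded_alg_inv = "('f, 'a, 'g) graded_alg" +
  involution :: "'a \<Rightarrow> 'a"

definition graded_equivalence ::
    "('f, 'a, 'g, 'm) graded_alg_scheme \<Rightarrow> ('f, 'b, 'h, 'n) graded_alg_scheme \<Rightarrow> ('a \<Rightarrow> 'b) \<Rightarrow> bool"
  where "graded_equivalence A B \<psi> \<longleftrightarrow>
    \<psi> \<in> ring_iso A B \<and>
    (\<forall>a. \<forall>x\<in>carrier A. \<psi> (a \<odot>\<^bsub>A\<^esub> x) = a \<odot>\<^bsub>B\<^esub> \<psi> x) \<and>
    (\<forall>g\<in>carrier (grading_group A). component A g \<noteq> {\<zero>\<^bsub>A\<^esub>} \<longrightarrow>
      (\<exists>h\<in>carrier (grading_group B). \<psi> ` component A g = component B h))"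

definition graded_inv_equivalence ::
    "('f, 'a, 'g, 'm) graded_alg_inv_scheme \<Rightarrow> ('f, 'b, 'h, 'n) graded_alg_inv_scheme
      \<Rightarrow> ('a \<Rightarrow> 'b) \<Rightarrow> bool"
  where "graded_inv_equivalence A B \<psi> \<longleftrightarrow>
    graded_equivalence A B \<psi> \<and>
    (\<forall>x\<in>carrier A. \<psi> (involution A x) = involution B (\<psi> x))"

definition graded_inv_equivalent ::
    "('f, 'a, 'g, 'm) graded_alg_inv_scheme \<Rightarrow> ('f, 'b, 'h, 'n) graded_alg_inv_scheme \<Rightarrow> bool"
  where "graded_inv_equivalent A B \<longleftrightarrow> (\<exists>\<psi>. graded_inv_equivalence A B \<psi>)"

section \<open>Graded-division algebras\<close>

locale graded_division_algebra = vector_space scale + group G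
  for scale :: "'f::field \<Rightarrow> 'd::ring_1 \<Rightarrow> 'd"
    and G :: "'g monoid" (structure)
    and Dc :: "'g \<Rightarrow> 'd set" +
  assumes scale_mult_left: "scale a x * y = scale a (x * y)"
    and scale_mult_right: "x * scale a y = scale a (x * y)"
    and subspace_Dc: "g \<in> carrier G \<Longrightarrow> subspace (Dc g)"
    and direct_sum: "\<exists>!f. (\<forall>g\<in>carrier G. f g \<in> Dc g) \<and> (\<forall>g. g \<notin> carrier G \<longrightarrow> f g = 0) \<and>
          finite {g. f g \<noteq> 0} \<and> x = (\<Sum>g | f g \<noteq> 0. f g)"
    and Dc_mult: "\<lbrakk>g \<in> carrier G; h \<in> carrier G; x \<in> Dc g; y \<in> Dc h\<rbrakk> \<Longrightarrow> x * y \<in> Dc (g \<otimes> h)"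
    and homogeneous_invertible: "\<lbrakk>g \<in> carrier G; x \<in> Dc g; x \<noteq> 0\<rbrakk> \<Longrightarrow> \<exists>y. x * y = 1 \<and> y * x = 1"

definition alg_of :: "('f \<Rightarrow> 'd::ring_1 \<Rightarrow> 'd) \<Rightarrow> 'g monoid \<Rightarrow> ('g \<Rightarrow> 'd set) \<Rightarrow> ('f, 'd, 'g) graded_alg"
  where "alg_of scale G Dc =
    \<lparr>carrier = UNIV, monoid.mult = (*), one = 1, ring.zero = 0, ring.add = (+), smult = scale,
     grading_group = G, component = Dc\<rparr>"

definition gr_support :: "'g monoid \<Rightarrow> ('g \<Rightarrow> 'd::zero set) \<Rightarrow> 'g set"
  where "gr_support G Dc = {g \<in> carrier G. Dc g \<noteq> {0}}"

definition gr_units :: "'g monoid \<Rightarrow> ('g \<Rightarrow> 'd::zero set) \<Rightarrow> 'd set"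
  where "gr_units G Dc = {x. x \<noteq> 0 \<and> (\<exists>g\<in>carrier G. x \<in> Dc g)}"

definition gr_degree :: "'g monoid \<Rightarrow> ('g \<Rightarrow> 'd set) \<Rightarrow> 'd \<Rightarrow> 'g"
  where "gr_degree G Dc x = (THE g. g \<in> carrier G \<and> x \<in> Dc g)"

definition Int_aut :: "('a, 'm) monoid_scheme \<Rightarrow> 'a \<Rightarrow> 'a \<Rightarrow> 'a"
  where "Int_aut A d x = d \<otimes>\<^bsub>A\<^esub> x \<otimes>\<^bsub>A\<^esub> inv\<^bsub>A\<^esub> d"

definition degree_preserving_involution ::
    "('f::field \<Rightarrow> 'd::ring_1 \<Rightarrow> 'd) \<Rightarrow> 'g monoid \<Rightarrow> ('g \<Rightarrow> 'd set) \<Rightarrow> ('d \<Rightarrow> 'd) \<Rightarrow> bool"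
  where "degree_preserving_involution scale G Dc \<phi> \<longleftrightarrow>
    Vector_Spaces.linear scale scale \<phi> \<and>
    (\<forall>x y. \<phi> (x * y) = \<phi> y * \<phi> x) \<and>
    (\<forall>x. \<phi> (\<phi> x) = x) \<and>
    (\<forall>g\<in>carrier G. \<phi> ` Dc g = Dc g)"

section \<open>The group \<open>G(T,q,s,t)\<close>\<close>

text \<open>
  Indices start at 0, so the generators are \<open>g\<^sub>0, \<dots>, g\<^sub>k\<^sub>-\<^sub>1\<close> with \<open>k = q + 2 s\<close>, and the
  hyperbolic pairs are \<open>(q + 2 j, q + 2 j + 1)\<close> for \<open>j < s\<close>. The factor \<open>F\<close> is written
  additively inside the library's \<^const>\<open>free_Abelian_group\<close>, hence the \<open>0\<close> below.
\<close>

definition presented_group :: "'g monoid \<Rightarrow> nat \<Rightarrow> ((nat \<Rightarrow>\<^sub>0 int) \<times> 'g) monoid"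
  where "presented_group T k = free_Abelian_group {..<k} \<times>\<times> T"

definition free_gen :: "'g monoid \<Rightarrow> nat \<Rightarrow> (nat \<Rightarrow>\<^sub>0 int) \<times> 'g"
  where "free_gen T i = (frag_of i, \<one>\<^bsub>T\<^esub>)"

definition equated_elements ::
    "'g monoid \<Rightarrow> nat \<Rightarrow> nat \<Rightarrow> 'g list \<Rightarrow> ((nat \<Rightarrow>\<^sub>0 int) \<times> 'g) set"
  where "equated_elements T q s t = (let P = presented_group T (q + 2 * s) in
    {free_gen T i [^]\<^bsub>P\<^esub> (2::nat) \<otimes>\<^bsub>P\<^esub> inv\<^bsub>P\<^esub> (0, t ! i) | i. i < q} \<union>
    {free_gen T (q + 2 * j) \<otimes>\<^bsub>P\<^esub> free_gen T (q + 2 * j + 1) | j. j < s})"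

definition relation_subgroup ::
    "'g monoid \<Rightarrow> nat \<Rightarrow> nat \<Rightarrow> 'g list \<Rightarrow> ((nat \<Rightarrow>\<^sub>0 int) \<times> 'g) set"
  where "relation_subgroup T q s t = (let P = presented_group T (q + 2 * s) in
    generate P {a \<otimes>\<^bsub>P\<^esub> inv\<^bsub>P\<^esub> b | a b.
      a \<in> equated_elements T q s t \<and> b \<in> equated_elements T q s t})"

text \<open>The subgroup above is normal because \<open>T\<close> is abelian wherever this is used.\<close>

definition G_tilde ::
    "'g monoid \<Rightarrow> nat \<Rightarrow> nat \<Rightarrow> 'g list \<Rightarrow> ((nat \<Rightarrow>\<^sub>0 int) \<times> 'g) set monoid"
  where "G_tilde T q s t = presented_group T (q + 2 * s) Mod relation_subgroup T q s t"

definition G_tilde_class ::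
    "'g monoid \<Rightarrow> nat \<Rightarrow> nat \<Rightarrow> 'g list \<Rightarrow> (nat \<Rightarrow>\<^sub>0 int) \<times> 'g \<Rightarrow> ((nat \<Rightarrow>\<^sub>0 int) \<times> 'g) set"
  where "G_tilde_class T q s t x =
    relation_subgroup T q s t #>\<^bsub>presented_group T (q + 2 * s)\<^esub> x"

definition matrix_degree ::
    "'g monoid \<Rightarrow> nat \<Rightarrow> nat \<Rightarrow> 'g list \<Rightarrow> nat \<Rightarrow> nat \<Rightarrow> 'g \<Rightarrow> ((nat \<Rightarrow>\<^sub>0 int) \<times> 'g) set"
  where "matrix_degree T q s t i j u = (let H = G_tilde T q s t; cl = G_tilde_class T q s t in
    cl (free_gen T i) \<otimes>\<^bsub>H\<^esub> inv\<^bsub>H\<^esub> cl (free_gen T j) \<otimes>\<^bsub>H\<^esub> cl (0, u))"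

section \<open>The graded algebra with involution \<open>M(D,\<phi>\<^sub>0,q,s,d,\<delta>)\<close>\<close>

definition M_data ::
    "('f::field \<Rightarrow> 'd::ring_1 \<Rightarrow> 'd) \<Rightarrow> 'g monoid \<Rightarrow> ('g \<Rightarrow> 'd set) \<Rightarrow>
     ('d \<Rightarrow> 'd) \<Rightarrow> nat \<Rightarrow> nat \<Rightarrow> 'd list \<Rightarrow> 'f \<Rightarrow> bool"
  where "M_data scale G Dc \<phi>\<^sub>0 q s d \<delta> \<longleftrightarrow>
    degree_preserving_involution scale G Dc \<phi>\<^sub>0 \<and>
    \<not> (q = 0 \<and> s = 0) \<and>
    \<delta> \<in> {1, -1} \<and>
    length d = q \<and>
    (\<forall>x\<in>set d. x \<in> gr_units G Dc \<and> \<phi>\<^sub>0 x = scale \<delta> x)"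

definition Phi_mat :: "('f::field \<Rightarrow> 'd::ring_1 \<Rightarrow> 'd) \<Rightarrow> nat \<Rightarrow> 'd list \<Rightarrow> 'f \<Rightarrow> 'd mat"
  where "Phi_mat scale s d \<delta> = diag_block_mat
    (map (\<lambda>x. mat_of_rows_list 1 [[x]]) d @
     replicate s (mat_of_rows_list 2 [[0, 1], [scale \<delta> 1, 0]]))"

definition matrix_alg :: "('f \<Rightarrow> 'd::ring_1 \<Rightarrow> 'd) \<Rightarrow> nat \<Rightarrow> ('f, 'd mat) module"
  where "matrix_alg scale k =
    \<lparr>carrier = carrier_mat k k, monoid.mult = (*), one = 1\<^sub>m k, ring.zero = 0\<^sub>m k k, ring.add = (+),
     smult = (\<lambda>a. map_mat (scale a))\<rparr>"

text \<open>
  The component of degree \<open>\<gamma>\<close> is the span of the \<open>E\<^sub>i\<^sub>j \<otimes> x\<close> with \<open>x\<close> in the component of degree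
  \<open>u\<close> of \<open>D\<close> and \<open>g\<^sub>i g\<^sub>j\<^sup>-\<^sup>1 u = \<gamma>\<close>; this is a condition on each entry separately.
\<close>

definition M_alg ::
    "('f::field \<Rightarrow> 'd::ring_1 \<Rightarrow> 'd) \<Rightarrow> 'g monoid \<Rightarrow> ('g \<Rightarrow> 'd set) \<Rightarrow>
     ('d \<Rightarrow> 'd) \<Rightarrow> nat \<Rightarrow> nat \<Rightarrow> 'd list \<Rightarrow> 'f \<Rightarrow>
     ('f, 'd mat, ((nat \<Rightarrow>\<^sub>0 int) \<times> 'g) set) graded_alg_inv"
  where "M_alg scale G Dc \<phi>\<^sub>0 q s d \<delta> =
    (let k = q + 2 * s;
         T = G\<lparr>carrier := gr_support G Dc\<rparr>;
         t = map (gr_degree G Dc) d;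
         A = matrix_alg scale k;
         \<Phi> = Phi_mat scale s d \<delta>
     in \<lparr>carrier = carrier A, monoid.mult = monoid.mult A, one = one A, ring.zero = ring.zero A,
         ring.add = ring.add A, smult = smult A,
         grading_group = G_tilde T q s t,
         component = (\<lambda>\<gamma>. {X \<in> carrier_mat k k. \<forall>i<k. \<forall>j<k.
           X $$ (i, j) \<in> Modules.module.span scale
             (\<Union>u\<in>{u \<in> carrier T. matrix_degree T q s t i j u = \<gamma>}. Dc u)}),
         involution = (\<lambda>X. inv\<^bsub>A\<^esub> \<Phi> * map_mat \<phi>\<^sub>0 (transpose_mat X) * \<Phi>)\<rparr>)"

end

(*
  In the group G~(T,q,s,t) two matrix units E_ij x and E_i'j' y (off the diagonal) have the same degree
  only if they coincide up to a scalar of degree e or are exchanged, up to such a scalar, by the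
  involution. Hence the nonzero homogeneous components are the diagonal copies of D_u and the spaces
  E_ij D_u + phi(E_ij D_u) with i <> j.

  An equivalence psi maps R_e, the diagonal matrices over the division algebra D_e, onto R'_e, so it
  permutes the minimal idempotents E_ii, by a bijection pi that commutes with the permutations induced
  by the involutions; counting fixed points gives q = q' and s = s'. It follows that
  psi(E_ij x) = E_{pi i, pi j} p_i psi_0(x) p_j^-1 with psi_0 a graded automorphism of D and p_i
  homogeneous. Comparing the involutions on E_ij x shows that phi_0'(p_i) f'_{pi i} p_{sigma i} psi_0(f_i)^-1,
  where the f_i are the nonzero entries of Phi, is an element c_0 independent of i, and (i)-(iii) can be
  read off. Conversely, the data of (i)-(iii) determine such p_i, and the above description of the
  components shows that the resulting isomorphism respects them.
*)
theory Submission
  imports Defs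
begin

section \<open>Degrees of matrix units\<close>

text \<open>An equivalence carries no map between the grading groups: it is only known to send
  components onto components. Degrees are therefore always handled through the question whether two
  elements have the same degree, and the presentation of the group serves only to decide this for
  matrix units. No normal form is needed for that: a subgroup cut out by parity and symmetry of
  exponents contains all relations and is small enough. Both implications rest on one equation. With
  P the sum of the E_{pi i, i} p_i, the map X -> P psi_0(X) P^{-1} commutes with the involutions if
  phi_0' psi_0 = Int(c_0) psi_0 phi_0 and phi_0'(P^T) Phi' P = c_0 psi_0(Phi). In entries the latter
  reads phi_0'(p_i) f'_{pi i} p_{sigma i} = c_0 psi_0(f_i). Sufficiency solves it for p_i, with 1
  and c_0 on each hyperbolic pair, where (ii) takes care of the second row; necessity solves it for
  d'. The c_i are the p_i in disguise: p_i = psi_0(phi_0(c_i))^{-1}.\<close>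

text \<open>The index permutation \<open>\<sigma>\<close> such that the involution maps position \<open>(i, j)\<close> to \<open>(\<sigma> j, \<sigma> i)\<close>.\<close>

definition mate :: "nat \<Rightarrow> nat \<Rightarrow> nat"
  where "mate q i = (if i < q then i else if even (i - q) then i + 1 else i - 1)"

lemma mate_less: "i < q + 2 * s \<Longrightarrow> mate q i < q + 2 * s"
  unfolding mate_def by (auto; presburger)

lemma mate_mate [simp]: "mate q (mate q i) = i"
  unfolding mate_def by (auto; presburger)

lemma mate_eq_iff [simp]: "mate q i = mate q j \<longleftrightarrow> i = j"
  by (metis mate_mate)

lemma mate_fixed_iff: "mate q i = i \<longleftrightarrow> i < q"
  unfolding mate_def by (auto; presburger)

lemma ge_mate: "q \<le> i \<Longrightarrow> q \<le> mate q i"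
  unfolding mate_def by (auto; presburger)

lemma mate_pair:
  "mate q (q + 2 * j) = q + 2 * j + 1" "mate q (q + 2 * j + 1) = q + 2 * j"
  unfolding mate_def by auto

lemma pair_cases:
  fixes q i s :: nat
  assumes "q \<le> i" "i < q + 2 * s"
  obtains j where "j < s" "i = q + 2 * j" | j where "j < s" "i = q + 2 * j + 1"
proof (cases "even (i - q)")
  case True
  then have "i = q + 2 * ((i - q) div 2)" "(i - q) div 2 < s"
    using assms by auto
  then show ?thesis using that by blast
next
  case False
  then have "i = q + 2 * ((i - q) div 2) + 1" "(i - q) div 2 < s"
    using assms by auto presburger+
  then show ?thesis using that by blast
qed

section \<open>The group given by generators and relations, and equality of degrees in it\<close>

locale tilde_group = comm_group T for T :: "'g monoid" (structure) +
  fixes q s :: nat and t :: "'g list"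
  assumes t_closed: "i < q \<Longrightarrow> t ! i \<in> carrier T"
begin

abbreviation "k \<equiv> q + 2 * s"
abbreviation "P \<equiv> presented_group T k"
abbreviation "N \<equiv> relation_subgroup T q s t"

text \<open>This is to become the degree of the nonzero entry of Phi in row \<open>i\<close>;
  hyperbolic rows contain 1 or delta, of trivial degree. With this convention squares and hyperbolic
  pairs need no separate treatment.\<close>

definition mult_deg :: "nat \<Rightarrow> 'g"
  where "mult_deg i = (if i < q then t ! i else \<one>)"

lemma mult_deg_closed [simp]: "mult_deg i \<in> carrier T"
  by (simp add: mult_deg_def t_closed)

lemma carrier_P: "carrier P = {a. Poly_Mapping.keys a \<subseteq> {..<k}} \<times> carrier T"
  by (auto simp: presented_group_def)

lemma mult_P [simp]: "(a, u) \<otimes>\<^bsub>P\<^esub> (b, v) = (a + b, u \<otimes> v)"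
  by (simp add: presented_group_def)

lemma one_P: "\<one>\<^bsub>P\<^esub> = (0, \<one>)"
  by (simp add: presented_group_def)

lemma comm_group_P: "comm_group P"
proof (rule group.group_comm_groupI)
  show "group P"
    unfolding presented_group_def by (intro DirProd_group group_free_Abelian_group is_group)
  show "x \<otimes>\<^bsub>P\<^esub> y = y \<otimes>\<^bsub>P\<^esub> x" if "x \<in> carrier P" "y \<in> carrier P" for x y
    using that by (cases x; cases y) (auto simp: carrier_P m_comm add.commute)
qed

sublocale P: comm_group P by (rule comm_group_P)

lemma inv_P [simp]: "(a, u) \<in> carrier P \<Longrightarrow> inv\<^bsub>P\<^esub> (a, u) = (- a, inv u)"
  by (rule P.inv_equality) (auto simp: carrier_P one_P)

lemma keys_frag_le: "i < k \<Longrightarrow> Poly_Mapping.keys (frag_of i) \<subseteq> {..<k}"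
  by simp

lemma keys_add_le:
  "Poly_Mapping.keys a \<subseteq> A \<Longrightarrow> Poly_Mapping.keys b \<subseteq> A \<Longrightarrow> Poly_Mapping.keys (a + b) \<subseteq> A"
  by (meson Poly_Mapping.keys_add Un_least subset_trans)

lemma keys_diff_le:
  "Poly_Mapping.keys a \<subseteq> A \<Longrightarrow> Poly_Mapping.keys b \<subseteq> A
    \<Longrightarrow> Poly_Mapping.keys (a - b :: nat \<Rightarrow>\<^sub>0 int) \<subseteq> A"
  by (meson keys_diff Un_least subset_trans)

text \<open>Since a diagonal index is its own mate, g_i^2 t_i^{-1} and g_i g_{i+1} are instances of
  one expression. Letting \<open>i\<close> run over all indices lists each hyperbolic product twice,
  which does no harm in a set.\<close>

lemma equated_eq:
  "equated_elements T q s t = {(frag_of i + frag_of (mate q i), inv (mult_deg i)) | i. i < k}"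
proof -
  have gen1: "free_gen T i [^]\<^bsub>P\<^esub> (2::nat) \<otimes>\<^bsub>P\<^esub> inv\<^bsub>P\<^esub> (0, t ! i)
      = (frag_of i + frag_of (mate q i), inv (mult_deg i))" if "i < q" for i
  proof -
    have "free_gen T i \<in> carrier P" "(0, t ! i) \<in> carrier P"
      using that by (auto simp: carrier_P free_gen_def t_closed)
    moreover have "x [^]\<^bsub>P\<^esub> (2::nat) = x \<otimes>\<^bsub>P\<^esub> x" if "x \<in> carrier P" for x
      using that P.nat_pow_Suc[of x 1] P.nat_pow_Suc[of x 0] P.nat_pow_0 P.l_one by (metis One_nat_def Suc_1)
    ultimately show ?thesis
      using that by (simp add: free_gen_def mate_def mult_deg_def t_closed)
  qed
  have gen2: "free_gen T (q + 2 * j) \<otimes>\<^bsub>P\<^esub> free_gen T (q + 2 * j + 1)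
      = (frag_of i + frag_of (mate q i), inv (mult_deg i))"
      if "j < s" "i = q + 2 * j \<or> i = q + 2 * j + 1" for i j
    using that(2) mate_pair[of q j] by (auto simp: free_gen_def mult_deg_def add.commute)
  show ?thesis (is "?L = ?R")
  proof (intro subset_antisym subsetI)
    fix x assume "x \<in> equated_elements T q s t"
    then consider i where "i < q" "x = free_gen T i [^]\<^bsub>P\<^esub> (2::nat) \<otimes>\<^bsub>P\<^esub> inv\<^bsub>P\<^esub> (0, t ! i)"
      | j where "j < s" "x = free_gen T (q + 2 * j) \<otimes>\<^bsub>P\<^esub> free_gen T (q + 2 * j + 1)"
      unfolding equated_elements_def Let_def by blast
    then show "x \<in> ?R"
    proof cases
      case 1 then show ?thesis using gen1 by fastforce
    next
      case (2 j)
      then have "q + 2 * j < k" by simp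
      then show ?thesis using 2 gen2[of j "q + 2 * j"] by blast
    qed
  next
    fix x assume "x \<in> ?R"
    then obtain i where i: "i < k" "x = (frag_of i + frag_of (mate q i), inv (mult_deg i))" by blast
    show "x \<in> equated_elements T q s t"
    proof (cases "i < q")
      case True
      then have "x = free_gen T i [^]\<^bsub>P\<^esub> (2::nat) \<otimes>\<^bsub>P\<^esub> inv\<^bsub>P\<^esub> (0, t ! i)" using i gen1 by simp
      then show ?thesis using True unfolding equated_elements_def Let_def by blast
    next
      case False
      then obtain j where "j < s" "i = q + 2 * j \<or> i = q + 2 * j + 1"
        using i pair_cases[of q i s] by (metis not_less)
      then have "x = free_gen T (q + 2 * j) \<otimes>\<^bsub>P\<^esub> free_gen T (q + 2 * j + 1)" using i gen2 by simp
      then show ?thesis using \<open>j < s\<close> unfolding equated_elements_def Let_def by blast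
    qed
  qed
qed

lemma equated_closed: "equated_elements T q s t \<subseteq> carrier P"
proof
  fix x assume "x \<in> equated_elements T q s t"
  then obtain i where "i < k" "x = (frag_of i + frag_of (mate q i), inv (mult_deg i))"
    by (auto simp: equated_eq)
  then show "x \<in> carrier P"
    using keys_add_le[OF keys_frag_le keys_frag_le, of i "mate q i"]
    by (simp add: carrier_P mate_less del: keys_add)
qed

text \<open>A subgroup containing the relations. Its last condition, which forces \<open>w = \<one>\<close> when \<open>a = 0\<close>,
  shows that \<open>T\<close> embeds into the quotient.\<close>

definition rel_inv :: "((nat \<Rightarrow>\<^sub>0 int) \<times> 'g) set"
  where "rel_inv = {(a, w). (a, w) \<in> carrier P \<and> (\<forall>i<q. even (Poly_Mapping.lookup a i)) \<and>
    (\<forall>i. q \<le> i \<and> i < k \<longrightarrow> Poly_Mapping.lookup a (mate q i) = Poly_Mapping.lookup a i) \<and>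
    w \<otimes> (\<Otimes>i\<in>{..<q}. (t ! i) [^] (Poly_Mapping.lookup a i div 2)) = \<one>}"

text \<open>Halving is additive and commutes with negation on even integers; this makes the product
  of the t_i with halved exponents multiplicative in \<open>a\<close>.\<close>

lemma subgroup_rel_inv: "subgroup rel_inv P"
proof (rule P.subgroupI)
  show "rel_inv \<subseteq> carrier P" by (auto simp: rel_inv_def)
  have "(0, \<one>) \<in> rel_inv" by (simp add: rel_inv_def carrier_P t_closed)
  then show "rel_inv \<noteq> {}" by blast
next
  fix x y assume xy: "x \<in> rel_inv" "y \<in> rel_inv"
  obtain a u b v where [simp]: "x = (a, u)" "y = (b, v)" by (metis surj_pair)
  have c: "u \<in> carrier T" "v \<in> carrier T" using xy by (auto simp: rel_inv_def carrier_P)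
  let ?f = "\<lambda>a. \<Otimes>i\<in>{..<q}. (t ! i) [^] (Poly_Mapping.lookup a i div 2)"
  have fc: "?f c \<in> carrier T" for c :: "nat \<Rightarrow>\<^sub>0 int" by (auto intro!: finprod_closed simp: t_closed)
  have "?f (a + b) = (\<Otimes>i\<in>{..<q}. (t ! i) [^] (Poly_Mapping.lookup a i div 2) \<otimes> (t ! i) [^] (Poly_Mapping.lookup b i div 2))"
    using xy
    by (intro finprod_cong')
       (auto simp: rel_inv_def lookup_add div_plus_div_distrib_dvd_left t_closed int_pow_mult)
  also have "\<dots> = ?f a \<otimes> ?f b"
    by (rule finprod_multf) (auto simp: t_closed)
  finally have "(u \<otimes> v) \<otimes> ?f (a + b) = (u \<otimes> ?f a) \<otimes> (v \<otimes> ?f b)"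
    using c fc by (simp add: m_ac)
  also have "\<dots> = \<one>" using xy by (auto simp: rel_inv_def)
  finally show "x \<otimes>\<^bsub>P\<^esub> y \<in> rel_inv"
    using xy P.m_closed[of x y] by (auto simp: rel_inv_def lookup_add)
next
  fix x assume x: "x \<in> rel_inv"
  obtain a u where [simp]: "x = (a, u)" by (metis surj_pair)
  have c: "u \<in> carrier T" "x \<in> carrier P" using x by (auto simp: rel_inv_def carrier_P)
  let ?f = "\<lambda>a. \<Otimes>i\<in>{..<q}. (t ! i) [^] (Poly_Mapping.lookup a i div 2)"
  have fc: "?f c \<in> carrier T" for c :: "nat \<Rightarrow>\<^sub>0 int" by (auto intro!: finprod_closed simp: t_closed)
  have "?f (- a) \<otimes> ?f a
      = (\<Otimes>i\<in>{..<q}. (t ! i) [^] (Poly_Mapping.lookup (- a) i div 2) \<otimes> (t ! i) [^] (Poly_Mapping.lookup a i div 2))"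
    by (rule finprod_multf[symmetric]) (auto simp: t_closed)
  also have "\<dots> = (\<Otimes>i\<in>{..<q}. \<one>)"
  proof (rule finprod_cong')
    fix i assume "i \<in> {..<q}"
    then have "even (Poly_Mapping.lookup a i)" "t ! i \<in> carrier T" using x by (auto simp: rel_inv_def t_closed)
    moreover have "(- Poly_Mapping.lookup a i) div 2 = - (Poly_Mapping.lookup a i div 2)"
      using \<open>even (Poly_Mapping.lookup a i)\<close> by (simp add: dvd_neg_div)
    ultimately show "(t ! i) [^] (Poly_Mapping.lookup (- a) i div 2) \<otimes> (t ! i) [^] (Poly_Mapping.lookup a i div 2) = \<one>"
      by (simp add: int_pow_neg)
  qed auto
  also have "\<dots> = \<one>" by simp
  finally have "?f (- a) \<otimes> ?f a = \<one>" .
  moreover have "u \<otimes> ?f a = \<one>" using x by (auto simp: rel_inv_def)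
  ultimately have "inv u \<otimes> ?f (- a) = \<one>"
    using c fc inv_equality[of "?f a" u] m_comm[OF c(1) fc[of a]] m_comm[OF fc[of a] fc[of "- a"]]
    by simp
  then show "inv\<^bsub>P\<^esub> x \<in> rel_inv"
    using x c P.inv_closed[of x] by (auto simp: rel_inv_def)
qed

text \<open>Although \<open>N\<close> is generated by quotients of the equated elements, the
  elements themselves already satisfy the conditions: the coefficient 2 at a diagonal
  \<open>i\<close> is halved to 1, and t_i cancels the inverse in the second component.\<close>

lemma equated_in_rel_inv: "equated_elements T q s t \<subseteq> rel_inv"
proof
  fix x assume x: "x \<in> equated_elements T q s t"
  then obtain i where i: "i < k" "x = (frag_of i + frag_of (mate q i), inv (mult_deg i))"
    by (auto simp: equated_eq)
  let ?a = "frag_of i + frag_of (mate q i)"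
  have l: "Poly_Mapping.lookup ?a j = (if j = i \<or> j = mate q i then if i < q then 2 else 1 else 0)" for j
    
    using mate_fixed_iff[of q i] by (auto simp: lookup_add lookup_single when_def)
  have p: "mult_deg i = (\<Otimes>j\<in>{..<q}. (t ! j) [^] (Poly_Mapping.lookup ?a j div 2))"
  proof (cases "i < q")
    case True
    then have "Poly_Mapping.lookup ?a j = (if i = j then 2 else 0)" for j
      using l[of j] mate_fixed_iff[of q i] by auto
    then have "(\<Otimes>j\<in>{..<q}. (t ! j) [^] (Poly_Mapping.lookup ?a j div 2))
        = (\<Otimes>j\<in>{..<q}. if i = j then t ! j else \<one>)"
      using True by (intro finprod_cong') (auto simp: t_closed)
    also have "\<dots> = t ! i" using True by (intro finprod_singleton) (auto simp: t_closed)
    finally show ?thesis using True by (simp add: mult_deg_def)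
  next
    case False
    then have "q \<le> mate q i" by (simp add: ge_mate)
    then have "(\<Otimes>j\<in>{..<q}. (t ! j) [^] (Poly_Mapping.lookup ?a j div 2)) = (\<Otimes>j\<in>{..<q}. \<one>)"
      using False by (intro finprod_cong') (auto simp: l)
    then show ?thesis using False by (simp add: mult_deg_def)
  qed
  have "x \<in> carrier P" using x equated_closed by blast
  moreover have "even (Poly_Mapping.lookup ?a j)" if "j < q" for j
    using that ge_mate[of q i] by (auto simp: l)
  moreover have "Poly_Mapping.lookup ?a (mate q j) = Poly_Mapping.lookup ?a j" for j
    using mate_eq_iff[of q j i] mate_mate[of q i] by (auto simp: l simp del: mate_eq_iff)
  ultimately show "x \<in> rel_inv"
    using i(2) unfolding rel_inv_def by (auto simp flip: p)
qed

lemma generators_closed: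
  "{a \<otimes>\<^bsub>P\<^esub> inv\<^bsub>P\<^esub> b | a b. a \<in> equated_elements T q s t \<and> b \<in> equated_elements T q s t}
    \<subseteq> carrier P"
  using equated_closed by blast

lemma subgroup_N: "subgroup N P"
  unfolding relation_subgroup_def Let_def by (rule P.generate_is_subgroup[OF generators_closed])

lemma normal_N: "N \<lhd> P"
  using subgroup_N P.normal_iff_subgroup by blast

lemma N_subset_rel_inv: "N \<subseteq> rel_inv"
  unfolding relation_subgroup_def Let_def
proof (rule P.generate_subgroup_incl[OF subsetI subgroup_rel_inv])
  interpret S: subgroup rel_inv P by (rule subgroup_rel_inv)
  fix x
  assume "x \<in> {a \<otimes>\<^bsub>P\<^esub> inv\<^bsub>P\<^esub> b | a b. a \<in> equated_elements T q s t \<and> b \<in> equated_elements T q s t}"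
  then obtain a b where "x = a \<otimes>\<^bsub>P\<^esub> inv\<^bsub>P\<^esub> b" "a \<in> rel_inv" "b \<in> rel_inv"
    using equated_in_rel_inv by blast
  then show "x \<in> rel_inv" by simp
qed

lemma N_trivial: "(0, w) \<in> N \<Longrightarrow> w = \<one>"
  using N_subset_rel_inv by (auto simp: rel_inv_def carrier_P t_closed)

text \<open>The relation g_i g_{sigma i} t_i^{-1} = g_j g_{sigma j} t_j^{-1}. Rearranged, it says
  that positions (i, j) and (sigma j, sigma i) share degrees up to an element of
  \<open>T\<close>.\<close>

lemma swap_in_N:
  assumes "i < k" "j < k"
  shows "(frag_of i + frag_of (mate q i) - frag_of j - frag_of (mate q j),
    mult_deg j \<otimes> inv (mult_deg i)) \<in> N"
proof -
  let ?e = "\<lambda>i. (frag_of i + frag_of (mate q i), inv (mult_deg i))"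
  have e: "?e i \<in> equated_elements T q s t" "?e j \<in> equated_elements T q s t"
    using assms by (auto simp: equated_eq)
  then have "?e i \<otimes>\<^bsub>P\<^esub> inv\<^bsub>P\<^esub> ?e j \<in> N"
    unfolding relation_subgroup_def Let_def by (intro generate.incl) blast
  moreover have "?e i \<otimes>\<^bsub>P\<^esub> inv\<^bsub>P\<^esub> ?e j
      = (frag_of i + frag_of (mate q i) - frag_of j - frag_of (mate q j),
         mult_deg j \<otimes> inv (mult_deg i))"
    using e equated_closed by (subst inv_P) (auto simp: m_comm)
  ultimately show ?thesis by simp
qed

lemma matrix_degree_eq:
  assumes "i < k" "j < k" "u \<in> carrier T"
  shows "matrix_degree T q s t i j u = N #>\<^bsub>P\<^esub> (frag_of i - frag_of j, u)"
proof -
  have c: "free_gen T i \<in> carrier P" "free_gen T j \<in> carrier P" "(0, u) \<in> carrier P"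
    using assms by (auto simp: free_gen_def carrier_P)
  interpret N: normal N P by (rule normal_N)
  have cj: "N #>\<^bsub>P\<^esub> free_gen T j \<in> carrier (P Mod N)"
    using c(2) by (auto simp: FactGroup_def RCOSETS_def)
  have "matrix_degree T q s t i j u
      = N #>\<^bsub>P\<^esub> (free_gen T i \<otimes>\<^bsub>P\<^esub> inv\<^bsub>P\<^esub> free_gen T j \<otimes>\<^bsub>P\<^esub> (0, u))"
    unfolding matrix_degree_def Let_def G_tilde_class_def G_tilde_def
    using c cj by (simp add: N.rcos_sum N.inv_FactGroup N.rcos_inv P.rcosetsI)

  then show ?thesis using c assms by (simp add: free_gen_def)
qed

lemma coset_eq_iff:
  assumes "(a, u) \<in> carrier P" "(b, v) \<in> carrier P"
  shows "N #>\<^bsub>P\<^esub> (a, u) = N #>\<^bsub>P\<^esub> (b, v) \<longleftrightarrow> (a - b, u \<otimes> inv v) \<in> N"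
proof -
  have "N #>\<^bsub>P\<^esub> (a, u) = N #>\<^bsub>P\<^esub> (b, v) \<longleftrightarrow> (a, u) \<otimes>\<^bsub>P\<^esub> inv\<^bsub>P\<^esub> (b, v) \<in> N"
    using P.rcos_self[OF assms(1) subgroup_N] P.repr_independence[OF _ assms(2) subgroup_N]
    by (metis P.coset_join1 assms P.coset_mult_inv1 P.coset_mult_inv2 P.inv_closed P.m_closed
        P.coset_join2 subgroup.subset subgroup_N)
  then show ?thesis using assms by (simp add: inv_P)
qed

text \<open>If two of the four terms cancel without giving one of the first two alternatives, some
  e_p - e_r with p \<noteq> r remains. The coefficient 1 at p is odd, so p is hyperbolic, and its
  mate must carry the coefficient 1 too, which is impossible. If nothing cancels, parity or symmetry
  at \<open>i\<close> and at \<open>j\<close> forces the mates to occur among the other two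
  terms.\<close>

lemma frag_relation_cases:
  assumes "i < k" "j < k" "i' < k" "j' < k"
    and "(frag_of i - frag_of j - (frag_of i' - frag_of j'), w) \<in> rel_inv"
  shows "i = j \<and> i' = j' \<or> i = i' \<and> j = j' \<or> i \<noteq> j \<and> i' = mate q j \<and> j' = mate q i"
proof -
  let ?a = "frag_of i - frag_of j - (frag_of i' - frag_of j')"
  have l: "Poly_Mapping.lookup ?a x = (if x = i then 1 else 0) - (if x = j then 1 else 0)
      - ((if x = i' then 1 else 0) - (if x = j' then 1 else 0))" for x
    by (auto simp: lookup_minus lookup_single when_def)
  have ev: "even (Poly_Mapping.lookup ?a x)" if "x < q" for x using assms(5) that by (auto simp: rel_inv_def)
  have pr: "Poly_Mapping.lookup ?a (mate q x) = Poly_Mapping.lookup ?a x" if "x < k" for x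
    using assms(5) that mate_fixed_iff[of q x]
    by (cases "x < q") (auto simp: rel_inv_def)
  have single: False
    if "\<And>x. Poly_Mapping.lookup ?a x = (if x = p then 1 else 0) - (if x = r then 1 else 0)" "p \<noteq> r" "p < k" for p r
  proof -
    have 1: "Poly_Mapping.lookup ?a p = 1" using that by simp
    then have "\<not> p < q" using ev[of p] by auto
    moreover have "mate q p = p" using pr[OF that(3)] 1 that(1)[of "mate q p"] by (auto split: if_splits)
    ultimately show False by (simp add: mate_fixed_iff)
  qed
  show ?thesis
  proof (rule ccontr)
    assume n: "\<not> ?thesis"
    have "i \<noteq> j" using n single[of j' i'] assms(4) unfolding l by auto
    moreover have "i' \<noteq> j'" using n single[of i j] assms(1) unfolding l by auto
    moreover have "i \<noteq> i'" using n single[of j' j] assms(4) unfolding l by auto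
    moreover have "j \<noteq> j'" using n single[of i i'] assms(1) unfolding l by auto
    moreover have "j' = mate q i"
    proof (cases "i < q")
      case True
      then show ?thesis
        using ev[of i] calculation mate_fixed_iff[of q i] unfolding l by (auto split: if_splits)
    next
      case False
      then have "mate q i \<noteq> i" by (simp add: mate_fixed_iff)
      then show ?thesis using pr[of i] assms(1) calculation unfolding l by (auto split: if_splits)
    qed
    moreover have "i' = mate q j"
    proof (cases "j < q")
      case True
      then show ?thesis
        using ev[of j] calculation mate_fixed_iff[of q j] unfolding l by (auto split: if_splits)
    next
      case False
      then have "mate q j \<noteq> j" by (simp add: mate_fixed_iff)
      then show ?thesis using pr[of j] assms(2) calculation unfolding l by (auto split: if_splits)
    qed
    ultimately show False using n by simp
  qed
qed

text \<open>The exponents restrict the positions to the three listed patterns; the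
  \<open>T\<close>-component is then determined because \<open>T\<close> embeds into the
  quotient.\<close>

theorem matrix_degree_eq_iff:
  assumes "i < k" "j < k" "i' < k" "j' < k" "u \<in> carrier T" "v \<in> carrier T"
  shows "matrix_degree T q s t i j u = matrix_degree T q s t i' j' v \<longleftrightarrow>
    i = j \<and> i' = j' \<and> u = v \<or> i = i' \<and> j = j' \<and> u = v \<or>
    i \<noteq> j \<and> i' = mate q j \<and> j' = mate q i \<and> v = u \<otimes> mult_deg i \<otimes> inv (mult_deg j)"
    (is "?L = ?R")
proof -
  let ?a = "frag_of i - frag_of j - (frag_of i' - frag_of j')"
  have L: "?L \<longleftrightarrow> (?a, u \<otimes> inv v) \<in> N"
    using assms by (simp add: matrix_degree_eq coset_eq_iff carrier_P keys_diff_le)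
  interpret N: subgroup N P by (rule subgroup_N)
  have one: "(0, \<one>) \<in> N" using N.one_closed by (simp add: one_P)
  have sw: "(?a, mult_deg j \<otimes> inv (mult_deg i)) \<in> N" if "i' = mate q j" "j' = mate q i"
    using swap_in_N[OF assms(1,2)] that by (simp add: algebra_simps)
  show ?thesis
  proof
    assume ?L
    then have a: "(?a, u \<otimes> inv v) \<in> N" using L by simp
    have uv: "u = v" if "u \<otimes> inv v = \<one>"
      using that assms by (metis inv_closed inv_equality inv_inv)
    consider "i = j \<and> i' = j' \<or> i = i' \<and> j = j'" | "i \<noteq> j" "i' = mate q j" "j' = mate q i"
      using frag_relation_cases[OF assms(1-4)] a N_subset_rel_inv by blast
    then show ?R
    proof cases
      case 1
      then have "(0, u \<otimes> inv v) \<in> N" using a by auto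
      then show ?thesis using N_trivial uv 1 by blast
    next
      case 2
      let ?w = "mult_deg j \<otimes> inv (mult_deg i)"
      \<comment> \<open>Dividing by the known element of \<open>N\<close> with the same exponents
        leaves an element of \<open>T\<close>, to which \<open>N_trivial\<close> applies.\<close>
      have "(?a, u \<otimes> inv v) \<otimes>\<^bsub>P\<^esub> inv\<^bsub>P\<^esub> (?a, ?w) \<in> N"
        using a sw[OF 2(2,3)] by blast
      moreover have "(?a, ?w) \<in> carrier P" using sw[OF 2(2,3)] by (rule N.mem_carrier)
      ultimately have "u \<otimes> inv v \<otimes> inv ?w = \<one>" using N_trivial by simp
      moreover have "u \<otimes> inv v \<otimes> inv ?w = (u \<otimes> mult_deg i \<otimes> inv (mult_deg j)) \<otimes> inv v"
        using assms by (simp add: inv_mult_group m_ac)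
      ultimately have "u \<otimes> mult_deg i \<otimes> inv (mult_deg j) = v"
        using assms by (metis inv_closed inv_equality inv_inv m_closed mult_deg_closed)
      then show ?thesis using 2 by simp
    qed
  next
    assume ?R
    then consider "i = j \<and> i' = j' \<or> i = i' \<and> j = j'" "u = v" 
      | "i' = mate q j" "j' = mate q i" "v = u \<otimes> mult_deg i \<otimes> inv (mult_deg j)" by blast
    then show ?L
    proof cases
      case 1
      then have "(?a, u \<otimes> inv v) = (0, \<one>)" using assms by auto
      then show ?thesis using L one by simp
    next
      case 2
      then have "u \<otimes> inv v = mult_deg j \<otimes> inv (mult_deg i)"
      proof -
        have "u \<otimes> inv v = u \<otimes> (mult_deg j \<otimes> (inv (mult_deg i) \<otimes> inv u))"
          using assms 2(3) by (simp add: inv_mult_group m_ac)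
        also have "\<dots> = mult_deg j \<otimes> inv (mult_deg i)"
          using assms by (simp add: m_lcomm[of u])
        finally show ?thesis .
      qed
      then show ?thesis using L sw[OF 2(1,2)] by simp
    qed
  qed
qed

text \<open>The exchange can fix a position (i, j) off the diagonal only if \<open>i\<close> and
  \<open>j\<close> are mates; both are then hyperbolic and the correcting factors are
  trivial.\<close>

lemma matrix_degree_inj:
  assumes "i < k" "j < k" "u \<in> carrier T" "v \<in> carrier T"
  shows "matrix_degree T q s t i j u = matrix_degree T q s t i j v \<longleftrightarrow> u = v"
proof -
  have "v = u" if "i \<noteq> j" "i = mate q j" "v = u \<otimes> mult_deg i \<otimes> inv (mult_deg j)"
  proof -
    have "\<not> i < q" "\<not> j < q" using that(1,2) mate_fixed_iff[of q i] mate_fixed_iff[of q j] by auto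
    then show ?thesis using that(3) assms by (simp add: mult_deg_def)
  qed
  then show ?thesis using matrix_degree_eq_iff[OF assms(1,2,1,2,3,4)] by auto
qed

lemma matrix_degree_in_carrier:
  assumes "i < k" "j < k" "u \<in> carrier T"
  shows "matrix_degree T q s t i j u \<in> carrier (G_tilde T q s t)"
proof -
  have "(frag_of i - frag_of j, u) \<in> carrier P"
    using assms by (simp add: carrier_P keys_diff_le)
  then show ?thesis
    unfolding matrix_degree_eq[OF assms] G_tilde_def FactGroup_def RCOSETS_def by auto
qed

end

section \<open>Graded-division algebras\<close>

definition uinv :: "'a::ring_1 \<Rightarrow> 'a"
  where "uinv x = (THE y. x * y = 1 \<and> y * x = 1)"

lemma uinv_eqI:
  assumes "x * y = 1" "y * x = 1"
  shows "uinv x = y"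
  unfolding uinv_def
proof (rule the_equality)
  show "z = y" if "x * z = 1 \<and> z * x = 1" for z
    using that assms by (metis mult.assoc mult_1_left mult_1_right)
qed (use assms in blast)

context graded_division_algebra
begin

abbreviation "U \<equiv> gr_units G Dc"
abbreviation "deg \<equiv> gr_degree G Dc"
abbreviation "T \<equiv> G\<lparr>carrier := gr_support G Dc\<rparr>"

lemma zero_Dc: "g \<in> carrier G \<Longrightarrow> 0 \<in> Dc g"
  using subspace_Dc subspace_0 by blast

text \<open>The sum also has the decomposition concentrated in degree \<open>h\<close>, and
  decompositions are unique.\<close>

lemma single_decomposition_unique:
  assumes f: "\<forall>g\<in>carrier G. f g \<in> Dc g" "\<forall>g. g \<notin> carrier G \<longrightarrow> f g = 0" "finite {g. f g \<noteq> 0}"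
    and sum: "(\<Sum>g | f g \<noteq> 0. f g) \<in> Dc h" and h: "h \<in> carrier G"
  shows "g \<noteq> h \<Longrightarrow> f g = 0"
proof -
  let ?x = "\<Sum>g | f g \<noteq> 0. f g"
  let ?f = "\<lambda>g. if g = h then ?x else 0"
  define Q where "Q = (\<lambda>f x. (\<forall>g\<in>carrier G. f g \<in> Dc g) \<and> (\<forall>g. g \<notin> carrier G \<longrightarrow> f g = 0) \<and>
      finite {g. f g \<noteq> 0} \<and> x = (\<Sum>g | f g \<noteq> 0. f g))"
  have "{g. ?f g \<noteq> 0} = (if ?x = 0 then {} else {h})" by auto
  then have "Q ?f ?x" unfolding Q_def using sum h by (auto simp: zero_Dc)
  moreover have "Q f ?x" unfolding Q_def using f by simp
  moreover have "\<exists>!f. Q f ?x" unfolding Q_def by (rule direct_sum)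
  ultimately have "f = ?f" by blast
  then show "g \<noteq> h \<Longrightarrow> f g = 0" by meson
qed

lemma Dc_unique:
  assumes "g \<in> carrier G" "h \<in> carrier G" "x \<in> Dc g" "x \<in> Dc h" "x \<noteq> 0"
  shows "g = h"
proof (rule ccontr)
  let ?f = "\<lambda>a. if a = g then x else 0"
  assume "g \<noteq> h"
  have "{a. ?f a \<noteq> 0} = {g}" using assms by auto
  then have "?f g = 0"
    using assms \<open>g \<noteq> h\<close> by (intro single_decomposition_unique[of ?f h g]) (auto simp: zero_Dc)
  then show False using assms by simp
qed

text \<open>Invertibility is assumed without any degree for the inverse; this lemma supplies it.
  Left multiplication by \<open>x\<close> is injective and shifts degrees by \<open>g\<close>, so it
  turns the decomposition of \<open>y\<close> into that of \<open>x * y\<close>, which has at most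
  one term.\<close>

lemma Dc_cancel_left:
  assumes "g \<in> carrier G" "h \<in> carrier G" "x \<in> Dc g" "x \<noteq> 0" "x * y \<in> Dc h"
  shows "y \<in> Dc (inv g \<otimes> h)"
proof -
  obtain x' where x': "x' * x = 1" using homogeneous_invertible assms by blast
  have inj: "x * z = 0 \<longleftrightarrow> z = 0" for z
    by (metis x' mult.assoc mult_1_left mult_zero_right)
  obtain f where f: "\<forall>g\<in>carrier G. f g \<in> Dc g" "\<forall>g. g \<notin> carrier G \<longrightarrow> f g = 0"
    "finite {g. f g \<noteq> 0}" "y = (\<Sum>g | f g \<noteq> 0. f g)"
    using direct_sum[of y] by blast
  \<comment> \<open>The component of \<open>x * y\<close> in degree \<open>a\<close> comes from the
    component of \<open>y\<close> in degree g^{-1} a.\<close>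
  let ?f = "\<lambda>a. if a \<in> carrier G then x * f (inv g \<otimes> a) else 0"
  have ne: "{a. ?f a \<noteq> 0} = (\<lambda>b. g \<otimes> b) ` {b. f b \<noteq> 0}"
  proof (intro subset_antisym subsetI)
    fix a assume "a \<in> {a. ?f a \<noteq> 0}"
    then have "a \<in> carrier G" "f (inv g \<otimes> a) \<noteq> 0" by (auto simp: inj split: if_splits)
    then show "a \<in> (\<lambda>b. g \<otimes> b) ` {b. f b \<noteq> 0}"
      using assms by (intro image_eqI[of _ _ "inv g \<otimes> a"]) (auto simp: m_assoc[symmetric])
  next
    fix a assume "a \<in> (\<lambda>b. g \<otimes> b) ` {b. f b \<noteq> 0}"
    then obtain b where "b \<in> carrier G" "a = g \<otimes> b" "f b \<noteq> 0" using f(2) by blast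
    then show "a \<in> {a. ?f a \<noteq> 0}" using assms by (auto simp: inj m_assoc[symmetric])
  qed
  have injg: "inj_on (\<lambda>b. g \<otimes> b) {b. f b \<noteq> 0}"
    using f(2) assms by (auto intro!: inj_onI) (metis inv_solve_left m_closed)
  have "(\<Sum>a | ?f a \<noteq> 0. ?f a) = (\<Sum>b | f b \<noteq> 0. x * f b)"
    unfolding ne sum.reindex[OF injg] comp_def
  proof (rule sum.cong[OF refl])
    fix b assume "b \<in> {b. f b \<noteq> 0}"
    then have "b \<in> carrier G" using f(2) by blast
    then show "?f (g \<otimes> b) = x * f b" using assms by (simp add: m_assoc[symmetric])
  qed
  also have "\<dots> = x * y" using f(4) by (simp add: sum_distrib_left)
  finally have s: "(\<Sum>a | ?f a \<noteq> 0. ?f a) = x * y" .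
  have "?f a \<in> Dc a" if "a \<in> carrier G" for a
    using that Dc_mult[OF assms(1) _ assms(3), of "inv g \<otimes> a" "f (inv g \<otimes> a)"] f(1) assms
    by (simp add: m_assoc[symmetric])
  then have z: "?f a = 0" if "a \<noteq> h" for a
    using that assms s f(3) by (intro single_decomposition_unique[of ?f h a]) (auto simp: ne)
  have "f b = 0" if "b \<noteq> inv g \<otimes> h" for b
  proof (cases "b \<in> carrier G")
    case True
    then have "g \<otimes> b \<noteq> h" using that assms by (auto simp: m_assoc[symmetric])
    then show ?thesis using z[of "g \<otimes> b"] True assms by (simp add: inj m_assoc[symmetric])
  qed (use f in blast)
  then have "{b. f b \<noteq> 0} \<subseteq> {inv g \<otimes> h}" by blast
  then have "y = f (inv g \<otimes> h)"
    using f(4) by (cases "f (inv g \<otimes> h) = 0") (auto simp: subset_singleton_iff)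
  then show ?thesis using f(1) assms by simp
qed

text \<open>Any nonzero homogeneous component c of 1 satisfies c 1 = c, and c can be
  cancelled.\<close>

lemma one_Dc: "1 \<in> Dc \<one>"
proof -
  obtain f where f: "\<forall>g\<in>carrier G. f g \<in> Dc g" "\<forall>g. g \<notin> carrier G \<longrightarrow> f g = 0"
    "finite {g. f g \<noteq> 0}" "1 = (\<Sum>g | f g \<noteq> 0. f g)"
    using direct_sum[of 1] by blast
  then obtain g where "f g \<noteq> 0" by (metis (mono_tags, lifting) mem_Collect_eq one_neq_zero sum.neutral)
  then have "g \<in> carrier G" "f g \<in> Dc g" using f by auto
  then show ?thesis using Dc_cancel_left[of g g "f g" 1] \<open>f g \<noteq> 0\<close> by simp
qed

lemma gr_unitE:
  assumes "x \<in> U" obtains g where "g \<in> carrier G" "x \<in> Dc g" "x \<noteq> 0" "deg x = g"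
proof -
  obtain g where g: "g \<in> carrier G" "x \<in> Dc g" "x \<noteq> 0" using assms by (auto simp: gr_units_def)
  then have "deg x = g" unfolding gr_degree_def using Dc_unique by blast
  then show ?thesis using that g by blast
qed

lemma gr_unitI: "g \<in> carrier G \<Longrightarrow> x \<in> Dc g \<Longrightarrow> x \<noteq> 0 \<Longrightarrow> x \<in> U"
  by (auto simp: gr_units_def)

lemma deg_eqI: "g \<in> carrier G \<Longrightarrow> x \<in> Dc g \<Longrightarrow> x \<noteq> 0 \<Longrightarrow> deg x = g"
  using gr_unitE gr_unitI Dc_unique by metis

lemma uinv_unit:
  assumes "x \<in> U"
  shows "x * uinv x = 1" "uinv x * x = 1"
proof -
  obtain y where "x * y = 1" "y * x = 1" using assms homogeneous_invertible by (metis gr_unitE)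
  then show "x * uinv x = 1" "uinv x * x = 1" using uinv_eqI by metis+
qed

lemma unit_cancel_simps [simp]:
  assumes "x \<in> U"
  shows "x * uinv x = 1" "uinv x * x = 1" "x * (uinv x * y) = y" "uinv x * (x * y) = y"
    "x * y = 0 \<longleftrightarrow> y = 0" "y * x = 0 \<longleftrightarrow> y = 0"
  using uinv_unit[OF assms]
  by (simp_all flip: mult.assoc) (metis mult.assoc mult_1_left mult_1_right mult_zero_left mult_zero_right)+

lemma unit_nonzero: "x \<in> U \<Longrightarrow> x \<noteq> 0"
  by (auto simp: gr_units_def)

lemma unit_mult_cancel:
  assumes "x \<in> U"
  shows "x * y = x * z \<longleftrightarrow> y = z" "y * x = z * x \<longleftrightarrow> y = z"
  using uinv_unit[OF assms] by (metis mult.assoc mult_1_left mult_1_right)+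

lemma Dc_uinv:
  assumes "g \<in> carrier G" "x \<in> Dc g" "x \<noteq> 0"
  shows "uinv x \<in> Dc (inv g)"
  using Dc_cancel_left[of g \<one> x "uinv x"] one_Dc uinv_unit[of x] gr_unitI assms by simp

lemma uinv_in_units [simp]: "x \<in> U \<Longrightarrow> uinv x \<in> U"
  by (metis Dc_uinv gr_unitE gr_unitI inv_closed mult_zero_right uinv_unit(1) zero_neq_one)

lemma mult_in_units [simp]: "x \<in> U \<Longrightarrow> y \<in> U \<Longrightarrow> x * y \<in> U"
  by (metis Dc_mult gr_unitE gr_unitI m_closed unit_cancel_simps(5))

lemma one_in_units [simp]: "1 \<in> U"
  using one_Dc by (intro gr_unitI[of \<one>]) auto

lemma uinv_uinv [simp]: "x \<in> U \<Longrightarrow> uinv (uinv x) = x"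
  by (intro uinv_eqI) auto

lemma uinv_mult: "x \<in> U \<Longrightarrow> y \<in> U \<Longrightarrow> uinv (x * y) = uinv y * uinv x"
  by (intro uinv_eqI) (simp_all add: mult.assoc)

lemma deg_in_support [simp]: "x \<in> U \<Longrightarrow> deg x \<in> gr_support G Dc"
  by (elim gr_unitE) (auto simp: gr_support_def)

lemma Dc_deg: "x \<in> U \<Longrightarrow> x \<in> Dc (deg x)"
  by (metis gr_unitE)

lemma deg_mult [simp]: "x \<in> U \<Longrightarrow> y \<in> U \<Longrightarrow> deg (x * y) = deg x \<otimes> deg y"
  by (metis Dc_mult gr_unitE deg_eqI m_closed unit_cancel_simps(5))

lemma deg_one [simp]: "deg 1 = \<one>"
  using one_Dc by (intro deg_eqI) auto

lemma deg_uinv [simp]: "x \<in> U \<Longrightarrow> deg (uinv x) = inv (deg x)"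
  by (metis Dc_uinv deg_eqI gr_unitE inv_closed unit_nonzero uinv_in_units)

lemma support_witness:
  assumes "g \<in> gr_support G Dc" obtains x where "x \<in> U" "deg x = g"
proof -
  have "g \<in> carrier G" using assms by (simp add: gr_support_def)
  moreover obtain x where "x \<in> Dc g" "x \<noteq> 0"
    using assms zero_Dc by (fastforce simp: gr_support_def)
  ultimately show ?thesis using that gr_unitI deg_eqI by metis
qed

lemma subgroup_support: "subgroup (gr_support G Dc) G"
proof
  show "gr_support G Dc \<subseteq> carrier G" by (auto simp: gr_support_def)
  show "\<one> \<in> gr_support G Dc" using deg_in_support[OF one_in_units] by simp
  show "g \<otimes> h \<in> gr_support G Dc" if "g \<in> gr_support G Dc" "h \<in> gr_support G Dc" for g h
    using that by (metis deg_in_support deg_mult mult_in_units support_witness)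
  show "inv g \<in> gr_support G Dc" if "g \<in> gr_support G Dc" for g
    using that by (metis deg_in_support deg_uinv uinv_in_units support_witness)
qed

lemma in_Dc_iff:
  assumes "g \<in> carrier G"
  shows "x \<in> Dc g \<longleftrightarrow> x = 0 \<or> x \<in> U \<and> deg x = g"
  using assms zero_Dc gr_unitI deg_eqI Dc_deg by metis

end

locale comm_graded_division_algebra = graded_division_algebra +
  assumes support_comm: "g \<in> gr_support G Dc \<Longrightarrow> h \<in> gr_support G Dc \<Longrightarrow> g \<otimes> h = h \<otimes> g"
begin

lemma comm_group_T: "comm_group T"
  using subgroup.subgroup_is_group[OF subgroup_support is_group] support_comm
  by (intro group.group_comm_groupI) auto

sublocale T: comm_group T by (rule comm_group_T)

lemma inv_T: "g \<in> gr_support G Dc \<Longrightarrow> inv\<^bsub>T\<^esub> g = inv g"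
  using m_inv_consistent[OF subgroup_support] by simp

end

section \<open>The graded algebra with involution\<close>

lemma index_mult_mat_sum:
  assumes "A \<in> carrier_mat n m" "B \<in> carrier_mat m l" "i < n" "j < l"
  shows "(A * B) $$ (i, j) = (\<Sum>c<m. A $$ (i, c) * B $$ (c, j))"
  using assms by (auto simp: scalar_prod_def lessThan_atLeast0 intro!: sum.cong)

lemma monoid_matrix_alg: "monoid (matrix_alg scale n)"
  by (rule monoidI) (auto simp: matrix_alg_def)

text \<open>The nonzero entry of Phi in row \<open>i\<close>, which stands in column
  \<open>mate (length d) i\<close>. The parity selects the upper or lower row of a hyperbolic
  block.\<close>

definition phi_coeff :: "('f::field \<Rightarrow> 'd::ring_1 \<Rightarrow> 'd) \<Rightarrow> 'd list \<Rightarrow> 'f \<Rightarrow> nat \<Rightarrow> 'd"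
  where "phi_coeff scale d \<delta> i =
    (if i < length d then d ! i else if even (i - length d) then 1 else scale \<delta> 1)"

text \<open>Induction on \<open>s\<close>: a further block in front shifts all indices by 2, and
  \<open>mate 0\<close> commutes with this shift. The general matrix is obtained later by prepending
  diagonal entries one at a time.\<close>

lemma hyperbolic_blocks:
  fixes e :: "'d::ring_1"
  defines "B \<equiv> mat_of_rows_list 2 [[0, 1], [e, 0]]"
  shows "diag_block_mat (replicate s B) \<in> carrier_mat (2 * s) (2 * s)" (is "?D s \<in> _")
    and "\<lbrakk>i < 2 * s; j < 2 * s\<rbrakk> \<Longrightarrow> diag_block_mat (replicate s B) $$ (i, j) =
      (if j = mate 0 i then if even i then 1 else e else 0)"
proof -
  have "?D s \<in> carrier_mat (2 * s) (2 * s) \<and> (\<forall>i<2*s. \<forall>j<2*s. ?D s $$ (i, j) =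
      (if j = mate 0 i then if even i then 1 else e else 0))"
  proof (induction s)
    case (Suc s)
    have B: "B \<in> carrier_mat 2 2" by (auto simp: B_def mat_of_rows_list_def)
    have D: "?D (Suc s) = four_block_mat B (0\<^sub>m 2 (2 * s)) (0\<^sub>m (2 * s) 2) (?D s)"
      using Suc B by (auto simp: Let_def)
    have "?D (Suc s) $$ (i, j) = (if j = mate 0 i then if even i then 1 else e else 0)"
      if ij: "i < 2 * Suc s" "j < 2 * Suc s" for i j
    proof (cases "i < 2")
      case True
      then consider "i = 0" | "i = 1" by linarith
      then show ?thesis
        using B Suc ij by cases (auto simp: D B_def mat_of_rows_list_def mate_def nth_Cons' less_2_cases_iff)
    next
      case False
      then obtain a where a: "i = Suc (Suc a)" by (metis add_2_eq_Suc le_Suc_ex not_less)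
      have ma: "mate 0 i = Suc (Suc (mate 0 a))" by (auto simp: a mate_def elim: oddE)
      show ?thesis
      proof (cases "j < 2")
        case True
        then show ?thesis using B Suc ij False by (auto simp: D ma)
      next
        case False
        then obtain b where "j = Suc (Suc b)" by (metis add_2_eq_Suc le_Suc_ex not_less)
        then show ?thesis using B Suc ij a ma by (auto simp: D)
      qed
    qed
    moreover have "?D (Suc s) \<in> carrier_mat (2 * Suc s) (2 * Suc s)" using B Suc by (auto simp: D)
    ultimately show ?case by blast
  qed (auto simp: mat_of_rows_list_def)
  then show "?D s \<in> carrier_mat (2 * s) (2 * s)"
    and "\<lbrakk>i < 2 * s; j < 2 * s\<rbrakk> \<Longrightarrow> ?D s $$ (i, j) = (if j = mate 0 i then if even i then 1 else e else 0)"
    by blast+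
qed

lemma Phi_mat_index:
  shows "Phi_mat scale s d \<delta> \<in> carrier_mat (length d + 2 * s) (length d + 2 * s)"
    and "\<lbrakk>i < length d + 2 * s; j < length d + 2 * s\<rbrakk> \<Longrightarrow>
      Phi_mat scale s d \<delta> $$ (i, j) = (if j = mate (length d) i then phi_coeff scale d \<delta> i else 0)"
proof -
  have "Phi_mat scale s d \<delta> \<in> carrier_mat (length d + 2 * s) (length d + 2 * s) \<and>
    (\<forall>i < length d + 2 * s. \<forall>j < length d + 2 * s. Phi_mat scale s d \<delta> $$ (i, j) =
      (if j = mate (length d) i then phi_coeff scale d \<delta> i else 0))" (is "?P d")
  proof (induction d)
    case Nil
    then show ?case
      using hyperbolic_blocks[where e = "scale \<delta> 1" and s = s] by (auto simp: Phi_mat_def phi_coeff_def)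
  next
    case (Cons x d)
    let ?n = "length d + 2 * s"
    have B: "mat_of_rows_list 1 [[x]] \<in> carrier_mat 1 1" by (simp add: mat_of_rows_list_def)
    have D: "Phi_mat scale s (x # d) \<delta>
        = four_block_mat (mat_of_rows_list 1 [[x]]) (0\<^sub>m 1 ?n) (0\<^sub>m ?n 1) (Phi_mat scale s d \<delta>)"
      using Cons B by (auto simp: Phi_mat_def Let_def)
    have "Phi_mat scale s (x # d) \<delta> $$ (i, j)
        = (if j = mate (Suc (length d)) i then phi_coeff scale (x # d) \<delta> i else 0)"
      if ij: "i < Suc ?n" "j < Suc ?n" for i j
    proof (cases i)
      case 0
      then show ?thesis
        using B Cons ij by (auto simp: D mat_of_rows_list_def mate_def phi_coeff_def)
    next
      case (Suc a)
      have ma: "mate (Suc (length d)) i = Suc (mate (length d) a)"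
        using Suc by (auto simp: mate_def elim: oddE)
      show ?thesis
        using B Cons ij Suc ma by (cases j) (auto simp: D phi_coeff_def)
    qed
    moreover have "Phi_mat scale s (x # d) \<delta> \<in> carrier_mat (Suc ?n) (Suc ?n)"
      using B Cons by (auto simp: D)
    ultimately show ?case by simp
  qed
  then show "Phi_mat scale s d \<delta> \<in> carrier_mat (length d + 2 * s) (length d + 2 * s)"
    and "\<lbrakk>i < length d + 2 * s; j < length d + 2 * s\<rbrakk> \<Longrightarrow>
      Phi_mat scale s d \<delta> $$ (i, j) = (if j = mate (length d) i then phi_coeff scale d \<delta> i else 0)"
    by blast+
qed

locale M_algebra = comm_graded_division_algebra scale G Dc
  for scale :: "'f::field \<Rightarrow> 'd::ring_1 \<Rightarrow> 'd" and G :: "'g monoid" (structure) and Dc +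
  fixes \<phi> :: "'d \<Rightarrow> 'd" and q s :: nat and d :: "'d list" and \<delta> :: 'f
  assumes data: "M_data scale G Dc \<phi> q s d \<delta>"
begin

abbreviation "n \<equiv> q + 2 * s"
abbreviation "\<sigma> \<equiv> mate q"
abbreviation "R \<equiv> M_alg scale G Dc \<phi> q s d \<delta>"

text \<open>The scalar delta as an element of D, so that signs can be moved by the ring laws: it is
  central, squares to 1, has trivial degree and is fixed by the involution.\<close>

definition eps :: 'd where "eps = scale \<delta> 1"
definition f :: "nat \<Rightarrow> 'd" where "f = phi_coeff scale d \<delta>"

lemma n_pos: "0 < n"
  using data by (auto simp: M_data_def)

lemma length_d: "length d = q"
  using data by (auto simp: M_data_def)

sublocale phi: Vector_Spaces.linear scale scale \<phi>
  using data by (simp add: M_data_def degree_preserving_involution_def)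

lemma phi_mult: "\<phi> (x * y) = \<phi> y * \<phi> x" and phi_phi [simp]: "\<phi> (\<phi> x) = x"
  using data by (auto simp: M_data_def degree_preserving_involution_def)

lemma phi_one [simp]: "\<phi> 1 = 1"
  by (metis mult_1_left mult_1_right phi_mult phi_phi)

lemma phi_zero_iff [simp]: "\<phi> x = 0 \<longleftrightarrow> x = 0"
  by (metis phi_phi phi.zero)

lemma phi_unit [simp]:
  assumes "x \<in> U" shows "\<phi> x \<in> U" "deg (\<phi> x) = deg x"
proof -
  obtain g where g: "g \<in> carrier G" "x \<in> Dc g" "x \<noteq> 0" "deg x = g" using assms by (rule gr_unitE)
  moreover have "\<phi> ` Dc g = Dc g"
    using data g(1) by (simp add: M_data_def degree_preserving_involution_def)
  ultimately have "\<phi> x \<in> Dc g" by blast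
  then show "\<phi> x \<in> U" "deg (\<phi> x) = deg x" using g by (auto intro: gr_unitI deg_eqI)
qed

lemma phi_uinv: "x \<in> U \<Longrightarrow> \<phi> (uinv x) = uinv (\<phi> x)"
  by (rule sym, rule uinv_eqI) (simp_all flip: phi_mult)

lemma scale_delta: "scale \<delta> x = eps * x"
  by (simp add: eps_def scale_mult_left)

lemma eps_commute: "x * eps = eps * x"
  by (simp add: eps_def scale_mult_left scale_mult_right)

lemma eps_eps [simp]: "eps * eps = 1" "eps * (eps * x) = x"
proof -
  have "\<delta> * \<delta> = 1" using data by (auto simp: M_data_def)
  then show "eps * eps = 1" by (simp add: eps_def scale_mult_left)
  then show "eps * (eps * x) = x" by (simp flip: mult.assoc)
qed

lemma eps_unit [simp]: "eps \<in> U" "deg eps = \<one>" "\<phi> eps = eps"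
proof -
  have 1: "eps \<in> Dc \<one>" using one_Dc subspace_Dc[of \<one>] by (simp add: eps_def subspace_scale)
  have 2: "eps \<noteq> 0" by (metis eps_eps(1) mult_zero_left zero_neq_one)
  show "eps \<in> U" "deg eps = \<one>" using 1 2 by (auto intro: gr_unitI deg_eqI)
  show "\<phi> eps = eps" by (simp add: eps_def phi.scale)
qed

lemma f_unit [simp]: "f i \<in> U"
proof (cases "i < q")
  case True
  then have "d ! i \<in> U" using data length_d by (auto simp: M_data_def)
  then show ?thesis using True by (simp add: f_def phi_coeff_def length_d)
qed (auto simp: f_def phi_coeff_def length_d simp flip: eps_def)

text \<open>This is phi_0(Phi^T) = delta Phi read entrywise. On diagonal rows it is the hypothesis
  on the d_i; on hyperbolic rows it comes from delta^2 = 1.\<close>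

lemma phi_f: "\<phi> (f i) = eps * f (\<sigma> i)"
proof (cases "i < q")
  case True
  then have "\<phi> (d ! i) = scale \<delta> (d ! i)" using data length_d by (auto simp: M_data_def)
  then show ?thesis using True by (simp add: f_def phi_coeff_def length_d mate_def scale_delta)
next
  case False
  then have "q \<le> \<sigma> i" "even (\<sigma> i - q) \<longleftrightarrow> odd (i - q)"
    by (auto simp: mate_def) presburger+
  then show ?thesis
    using False by (simp add: f_def phi_coeff_def length_d flip: eps_def)
qed

sublocale tg: tilde_group T q s "map deg d"
proof
  show "map deg d ! i \<in> carrier T" if "i < q" for i
    using that data length_d by (auto simp: M_data_def)
qed

lemma mult_deg_eq: "tg.mult_deg i = deg (f i)"
  by (auto simp: tg.mult_deg_def f_def phi_coeff_def length_d simp flip: eps_def)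

text \<open>The degree of E_ij x, as a function of the homogeneous element \<open>x\<close> rather
  than of its degree, because an equivalence acts on elements.\<close>

definition hdeg :: "nat \<Rightarrow> nat \<Rightarrow> 'd \<Rightarrow> ((nat \<Rightarrow>\<^sub>0 int) \<times> 'g) set"
  where "hdeg i j x = matrix_degree T q s (map deg d) i j (deg x)"

lemma hdeg_carrier: "i < n \<Longrightarrow> j < n \<Longrightarrow> x \<in> U \<Longrightarrow> hdeg i j x \<in> carrier (G_tilde T q s (map deg d))"
  unfolding hdeg_def by (rule tg.matrix_degree_in_carrier) auto

text \<open>In the third alternative the correction by the degrees of f_i and f_j is written as the
  degree of f_j^{-1} phi(x) f_i, the coefficient of the image of E_ij x under the involution. Maps
  that respect the involution can then be applied to it directly.\<close>

lemma hdeg_eq_iff: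
  assumes "i < n" "j < n" "i' < n" "j' < n" "x \<in> U" "y \<in> U"
  shows "hdeg i j x = hdeg i' j' y \<longleftrightarrow>
    i = j \<and> i' = j' \<and> deg x = deg y \<or> i = i' \<and> j = j' \<and> deg x = deg y \<or>
    i \<noteq> j \<and> i' = \<sigma> j \<and> j' = \<sigma> i \<and> deg y = deg (uinv (f j) * \<phi> x * f i)"
proof -
  have "deg (uinv (f j) * \<phi> x * f i) = deg x \<otimes> deg (f i) \<otimes> inv\<^bsub>T\<^esub> deg (f j)"
    using assms T.m_comm[of "inv (deg (f j))" "deg x \<otimes> deg (f i)"]
      deg_in_support[OF uinv_in_units[of "f j"]] T.m_closed[of "deg x" "deg (f i)"]
    by (simp add: inv_T subgroup.mem_carrier[OF subgroup_support] m_assoc)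
  then show ?thesis
    using assms tg.matrix_degree_eq_iff[OF assms(1-4), of "deg x" "deg y"]
    by (simp add: hdeg_def mult_deg_eq)
qed

lemma hdeg_diag:
  "\<lbrakk>i < n; j < n; x \<in> U; y \<in> U; deg x = deg y\<rbrakk> \<Longrightarrow> hdeg i i x = hdeg j j y"
  by (subst hdeg_eq_iff) blast+

lemma hdeg_swap:
  assumes "i < n" "j < n" "x \<in> U" "y \<in> U" "i \<noteq> j" "deg y = deg (uinv (f j) * \<phi> x * f i)"
  shows "hdeg i j x = hdeg (\<sigma> j) (\<sigma> i) y"
  using assms mate_less by (subst hdeg_eq_iff) blast+

lemma hdeg_inj: "\<lbrakk>i < n; j < n; x \<in> U; y \<in> U\<rbrakk> \<Longrightarrow> hdeg i j x = hdeg i j y \<longleftrightarrow> deg x = deg y"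
  unfolding hdeg_def by (rule tg.matrix_degree_inj) auto

lemma R_simps [simp]:
  "carrier R = carrier_mat n n" "monoid.mult R = (*)" "one R = 1\<^sub>m n" "ring.zero R = 0\<^sub>m n n"
  "ring.add R = (+)" "smult R = (\<lambda>a. map_mat (scale a))"
  "grading_group R = G_tilde T q s (map deg d)"
  by (simp_all add: M_alg_def Let_def matrix_alg_def)

text \<open>At a fixed position at most one degree of D contributes to \<open>\<gamma>\<close>, by
  \<open>matrix_degree_inj\<close>; the span in the definition is therefore a single component of D
  or zero.\<close>

lemma component_iff:
  "X \<in> component R \<gamma> \<longleftrightarrow> X \<in> carrier_mat n n \<and>
    (\<forall>i<n. \<forall>j<n. X $$ (i, j) \<noteq> 0 \<longrightarrow> X $$ (i, j) \<in> U \<and> hdeg i j (X $$ (i, j)) = \<gamma>)"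
proof -
  have "x \<in> span (\<Union>u\<in>{u \<in> carrier T. matrix_degree T q s (map deg d) i j u = \<gamma>}. Dc u) \<longleftrightarrow>
      x = 0 \<or> x \<in> U \<and> hdeg i j x = \<gamma>" (is "x \<in> span (\<Union>u\<in>?S. _) \<longleftrightarrow> _")
    if "i < n" "j < n" for i j x
  proof (cases "\<exists>u. u \<in> ?S")
    case True
    then obtain u where u: "u \<in> gr_support G Dc" "matrix_degree T q s (map deg d) i j u = \<gamma>" by auto
    then have eq: "matrix_degree T q s (map deg d) i j v = \<gamma> \<longleftrightarrow> v = u" if "v \<in> gr_support G Dc" for v
      using tg.matrix_degree_inj[OF \<open>i < n\<close> \<open>j < n\<close>, of v u] that by auto
    then have "?S = {u}" using u by auto
    moreover have uG: "u \<in> carrier G" using u by (simp add: gr_support_def)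
    moreover have "span (Dc u) = Dc u" using subspace_Dc[OF uG] by (simp add: span_eq_iff)
    ultimately have sp: "span (\<Union>u\<in>?S. Dc u) = Dc u" by (simp only: UN_insert UN_empty Un_empty_right)
    show ?thesis unfolding sp in_Dc_iff[OF uG] hdeg_def using eq[of "deg x"] deg_in_support[of x] by auto
  next
    case False
    then have "?S = {}" by blast
    then have sp: "span (\<Union>u\<in>?S. Dc u) = {0}" by (simp only: UN_empty span_empty)
    have "deg x \<in> ?S" if "x \<in> U" "hdeg i j x = \<gamma>" using that by (simp add: hdeg_def)
    then show ?thesis unfolding sp using False by blast
  qed
  then show ?thesis by (auto simp: M_alg_def Let_def)
qed

lemma involution_index:
  assumes "X \<in> carrier_mat n n" "a < n" "b < n"
  shows "involution R X $$ (a, b) = uinv (f (\<sigma> a)) * \<phi> (X $$ (\<sigma> b, \<sigma> a)) * f (\<sigma> b)"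
    and "involution R X \<in> carrier_mat n n"
proof -
  let ?\<Phi> = "Phi_mat scale s d \<delta>"
  \<comment> \<open>Phi is monomial with pattern \<open>\<sigma>\<close>, and so is its inverse;
    every entry of the triple product then reduces to one term.\<close>
  let ?\<Psi> = "mat n n (\<lambda>(i, j). if j = \<sigma> i then uinv (f j) else 0)"
  let ?A = "matrix_alg scale n"
  note Phi = Phi_mat_index[where scale = scale and s = s and d = d and \<delta> = \<delta>, unfolded length_d, folded f_def]
  have Psi: "?\<Psi> \<in> carrier_mat n n" by simp
  have sw: "j = \<sigma> i \<longleftrightarrow> i = \<sigma> j" for i j by auto
  have sl: "\<sigma> i < n" if "i < n" for i using mate_less that .
  have L: "(?\<Psi> * Y) $$ (i, j) = uinv (f (\<sigma> i)) * Y $$ (\<sigma> i, j)"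
    if "Y \<in> carrier_mat n n" "i < n" "j < n" for Y i j
    using that sl by (subst index_mult_mat_sum[OF Psi]) (auto simp: if_distrib[of "\<lambda>x. x * _"] cong: if_cong)
  have M: "(Y * ?\<Phi>) $$ (i, j) = Y $$ (i, \<sigma> j) * f (\<sigma> j)"
    if "Y \<in> carrier_mat n n" "i < n" "j < n" for Y i j
  proof -
    have "(Y * ?\<Phi>) $$ (i, j) = (\<Sum>c<n. if c = \<sigma> j then Y $$ (i, c) * f c else 0)"
      unfolding index_mult_mat_sum[OF that(1) Phi(1) that(2,3)]
      using that by (intro sum.cong) (auto simp: Phi(2) sw)
    then show ?thesis using that sl by simp
  qed
  have 1: "?\<Psi> * ?\<Phi> = 1\<^sub>m n"
    using Phi sl by (intro eq_matI) (auto simp: L simp del: index_mult_mat(1))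
  have 2: "?\<Phi> * ?\<Psi> = 1\<^sub>m n"
  proof (intro eq_matI)
    fix i j assume ij: "i < dim_row (1\<^sub>m n :: 'd mat)" "j < dim_col (1\<^sub>m n :: 'd mat)"
    then have "(?\<Phi> * ?\<Psi>) $$ (i, j) = (\<Sum>c<n. if c = \<sigma> i then f i * ?\<Psi> $$ (c, j) else 0)"
      by (subst index_mult_mat_sum[OF Phi(1) Psi]; (intro sum.cong)?) (auto simp: Phi(2))
    then show "(?\<Phi> * ?\<Psi>) $$ (i, j) = 1\<^sub>m n $$ (i, j)"
      using ij sl by simp
  qed (use Phi in auto)
  have "inv\<^bsub>?A\<^esub> ?\<Phi> = ?\<Psi>"
    using Phi(1) Psi 1 2
    by (intro monoid.inv_unique'[OF monoid_matrix_alg, symmetric]) (auto simp: matrix_alg_def)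
  then have I: "involution R X = ?\<Psi> * map_mat \<phi> (transpose_mat X) * ?\<Phi>"
    by (simp add: M_alg_def Let_def)
  let ?Y = "map_mat \<phi> (transpose_mat X)"
  have Y: "?Y \<in> carrier_mat n n" "?\<Psi> * ?Y \<in> carrier_mat n n" using assms Psi by auto
  show "involution R X \<in> carrier_mat n n" unfolding I using Y(2) Phi(1) by simp
  show "involution R X $$ (a, b) = uinv (f (\<sigma> a)) * \<phi> (X $$ (\<sigma> b, \<sigma> a)) * f (\<sigma> b)"
    unfolding I using assms sl by (simp add: M[OF Y(2)] L[OF Y(1)] del: index_mult_mat(1))
qed

end

section \<open>Graded automorphisms of D\<close>

context comm_graded_division_algebra
begin

definition graded_automorphism :: "('b \<Rightarrow> 'b) \<Rightarrow> bool"
  where "graded_automorphism \<psi> \<longleftrightarrow> bij \<psi> \<and> (\<forall>x y. \<psi> (x + y) = \<psi> x + \<psi> y) \<and>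
    (\<forall>x y. \<psi> (x * y) = \<psi> x * \<psi> y) \<and> \<psi> 1 = 1 \<and> (\<forall>a x. \<psi> (scale a x) = scale a (\<psi> x)) \<and>
    (\<forall>g\<in>carrier G. Dc g \<noteq> {0} \<longrightarrow> (\<exists>h\<in>carrier G. \<psi> ` Dc g = Dc h))"

lemma graded_equivalence_iff:
  "graded_equivalence (alg_of scale G Dc) (alg_of scale G Dc) \<psi> \<longleftrightarrow> graded_automorphism \<psi>"
  by (auto simp: graded_equivalence_def graded_automorphism_def alg_of_def ring_iso_def ring_hom_def)

lemma Int_aut_unit:
  assumes "c \<in> U"
  shows "Int_aut (alg_of scale G Dc) c x = c * x * uinv c"
proof -
  let ?A = "alg_of scale G Dc"
  have "monoid ?A" by (rule monoidI) (auto simp: alg_of_def mult.assoc)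
  then have "uinv c = inv\<^bsub>?A\<^esub> c"
    using assms by (intro monoid.inv_unique') (auto simp: alg_of_def)
  then show ?thesis by (simp add: Int_aut_def) (simp add: alg_of_def)
qed

end

locale comm_graded_automorphism = comm_graded_division_algebra scale G Dc
  for scale :: "'f::field \<Rightarrow> 'd::ring_1 \<Rightarrow> 'd" and G :: "'g monoid" (structure) and Dc +
  fixes \<psi> :: "'d \<Rightarrow> 'd"
  assumes aut: "graded_automorphism \<psi>"
begin

lemma bij_psi: "bij \<psi>" and psi_add: "\<psi> (x + y) = \<psi> x + \<psi> y"
  and psi_mult: "\<psi> (x * y) = \<psi> x * \<psi> y" and psi_one [simp]: "\<psi> 1 = 1"
  and psi_scale: "\<psi> (scale a x) = scale a (\<psi> x)"
  using aut by (auto simp: graded_automorphism_def)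

lemma psi_zero [simp]: "\<psi> 0 = 0"
  using psi_add[of 0 0] by simp

lemma psi_zero_iff [simp]: "\<psi> x = 0 \<longleftrightarrow> x = 0"
  using bij_psi psi_zero by (metis bij_pointE)

lemma psi_sum: "\<psi> (sum h S) = (\<Sum>x\<in>S. \<psi> (h x))"
  by (induction S rule: infinite_finite_induct) (auto simp: psi_add)

lemma psi_component:
  assumes "x \<in> U"
  obtains h where "h \<in> carrier G" "\<psi> ` Dc (deg x) = Dc h"
proof -
  have "Dc (deg x) \<noteq> {0}" "deg x \<in> carrier G"
    using deg_in_support[OF assms] by (auto simp: gr_support_def)
  moreover have "\<forall>g\<in>carrier G. Dc g \<noteq> {0} \<longrightarrow> (\<exists>h\<in>carrier G. \<psi> ` Dc g = Dc h)"
    using aut by (simp add: graded_automorphism_def)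
  ultimately show ?thesis using that by blast
qed

lemma psi_unit [simp]: "x \<in> U \<Longrightarrow> \<psi> x \<in> U"
  by (metis Dc_deg gr_unitI image_eqI psi_component psi_zero_iff unit_nonzero)

lemma psi_uinv: "x \<in> U \<Longrightarrow> \<psi> (uinv x) = uinv (\<psi> x)"
  by (rule sym, rule uinv_eqI) (simp_all flip: psi_mult)

text \<open>The image of the component of \<open>x\<close> is a whole component. It contains the
  image of \<open>x\<close>, so it is the component in which \<open>y\<close> lies.\<close>

lemma psi_deg_eqD:
  assumes "x \<in> U" "y \<in> U" "deg y = deg (\<psi> x)"
  obtains z where "z \<in> U" "\<psi> z = y" "deg z = deg x"
proof -
  obtain h where h: "h \<in> carrier G" "\<psi> ` Dc (deg x) = Dc h" using psi_component assms(1) by blast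
  then have "\<psi> x \<in> Dc h" using Dc_deg[OF assms(1)] by blast
  then have "deg (\<psi> x) = h" using h assms by (intro deg_eqI) (auto simp: unit_nonzero)
  then have "y \<in> \<psi> ` Dc (deg x)" using Dc_deg[OF assms(2)] h assms(3) by simp
  then obtain z where z: "z \<in> Dc (deg x)" "\<psi> z = y" by blast
  moreover have "deg x \<in> carrier G" using deg_in_support[OF assms(1)] by (simp add: gr_support_def)
  moreover have "z \<noteq> 0" using z(2) assms(2) unit_nonzero psi_zero by metis
  ultimately show ?thesis using that gr_unitI deg_eqI by blast
qed

lemma psi_deg_cong:
  assumes "x \<in> U" "y \<in> U" "deg x = deg y"
  shows "deg (\<psi> x) = deg (\<psi> y)"
proof -
  obtain h where h: "h \<in> carrier G" "\<psi> ` Dc (deg x) = Dc h" using psi_component assms(1) by blast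
  then have "\<psi> x \<in> Dc h" "\<psi> y \<in> Dc h" using Dc_deg[of x] Dc_deg[of y] assms by auto
  then show ?thesis using h assms deg_eqI psi_unit unit_nonzero by metis
qed

end

section \<open>Equivalences from monomial matrices\<close>

lemma (in comm_graded_division_algebra) deg_conj_cong:
  assumes "x \<in> U" "y \<in> U" "u \<in> U" "v \<in> U" "deg x = deg y"
  shows "deg (u * x * v) = deg (u * y * v)"
  using assms by simp

lemma (in comm_graded_division_algebra) deg_conj:
  assumes "x \<in> U" "u \<in> U"
  shows "deg (u * x * uinv u) = deg x"
proof -
  have "deg u \<otimes> deg x = deg x \<otimes> deg u" using assms by (intro support_comm) auto
  then have "deg (u * x) = deg (x * u)" using assms by simp
  then have "deg (u * x * uinv u) = deg (x * u * uinv u)" using assms by simp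
  then show ?thesis using assms by (simp add: mult.assoc del: deg_mult)
qed

text \<open>The assumption \<open>form\<close> states phi_0'(P^T) Phi' P = c_0 psi_0(Phi) entry by
  entry, P being the monomial matrix with entry \<open>p i\<close> at position (pi i, i). Here
  \<open>\<pi>\<close> may be taken to fix all hyperbolic indices, since (iii) rearranges only the
  diagonal entries.\<close>

locale M_transport = comm_graded_division_algebra scale G Dc +
  A: M_algebra scale G Dc \<phi> q s d \<delta> + B: M_algebra scale G Dc \<phi>' q s d' \<delta>' +
  comm_graded_automorphism scale G Dc \<psi>\<^sub>0
  for scale :: "'f::field \<Rightarrow> 'd::ring_1 \<Rightarrow> 'd" and G :: "'g monoid" (structure) and Dc
    and \<phi> q s d \<delta> \<phi>' d' \<delta>' \<psi>\<^sub>0 +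
  fixes p :: "nat \<Rightarrow> 'd" and \<pi> :: "nat \<Rightarrow> nat" and c\<^sub>0 :: 'd
  assumes p_unit [simp]: "p i \<in> U" and c0_unit [simp]: "c\<^sub>0 \<in> U"
    and pi: "\<pi> permutes {..<q}"
    and twist: "\<phi>' (\<psi>\<^sub>0 x) = c\<^sub>0 * \<psi>\<^sub>0 (\<phi> x) * uinv c\<^sub>0"
    and form: "i < q + 2 * s \<Longrightarrow> \<phi>' (p i) * B.f (\<pi> i) * p (mate q i) = c\<^sub>0 * \<psi>\<^sub>0 (A.f i)"
begin

abbreviation "n \<equiv> q + 2 * s"
abbreviation "\<sigma> \<equiv> mate q"
abbreviation "\<rho> \<equiv> inv_into UNIV \<pi>"

lemma pi_rho [simp]: "\<pi> (\<rho> i) = i" "\<rho> (\<pi> i) = i"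
  using pi by (simp_all add: permutes_inverses)

lemma pi_less [simp]: "\<pi> i < n \<longleftrightarrow> i < n"
  using pi permutes_in_image[OF pi, of i] permutes_not_in[OF pi, of i]
  by (metis lessThan_iff trans_less_add1)

lemma rho_less [simp]: "\<rho> i < n \<longleftrightarrow> i < n"
  by (metis pi_less pi_rho(1))

lemma pi_eq_iff [simp]: "\<pi> i = \<pi> j \<longleftrightarrow> i = j"
  by (metis pi_rho(2))

lemma pi_mate: "\<pi> (\<sigma> i) = \<sigma> (\<pi> i)"
proof (cases "i < q")
  case True
  then have "\<pi> i < q" using permutes_in_image[OF pi, of i] by simp
  then show ?thesis using True mate_fixed_iff by metis
next
  case False
  then have "\<pi> i = i" "\<pi> (\<sigma> i) = \<sigma> i"
    using permutes_not_in[OF pi, of i] permutes_not_in[OF pi, of "\<sigma> i"] ge_mate[of q i] by auto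
  then show ?thesis by simp
qed

lemma sigma_less: "i < n \<Longrightarrow> \<sigma> i < n"
  by (rule mate_less)

definition \<theta> :: "nat \<Rightarrow> nat \<Rightarrow> 'd \<Rightarrow> 'd"
  where "\<theta> i j x = p i * \<psi>\<^sub>0 x * uinv (p j)"

lemma theta_unit [simp]: "x \<in> U \<Longrightarrow> \<theta> i j x \<in> U"
  by (simp add: \<theta>_def)

lemma theta_zero_iff [simp]: "\<theta> i j x = 0 \<longleftrightarrow> x = 0"
  by (simp add: \<theta>_def)

text \<open>Compatibility with the involutions, tested on E_ij x. Solving \<open>form\<close> for
  phi'(p_i) f'_{pi i}, and inverting it at \<open>j\<close>, produces c_0 on one side and its
  inverse on the other; they cancel against those in \<open>twist\<close>.\<close>

lemma theta_involution:
  assumes "i < n" "j < n"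
  shows "\<theta> (\<sigma> j) (\<sigma> i) (uinv (A.f j) * \<phi> x * A.f i)
    = uinv (B.f (\<pi> j)) * \<phi>' (\<theta> i j x) * B.f (\<pi> i)"
proof -
  have c: "\<phi>' (p i) * B.f (\<pi> i) = c\<^sub>0 * \<psi>\<^sub>0 (A.f i) * uinv (p (\<sigma> i))" if "i < n" for i
    unfolding form[OF that, symmetric] by (simp add: mult.assoc)
  have "uinv (\<phi>' (p j) * B.f (\<pi> j)) = p (\<sigma> j) * uinv (\<psi>\<^sub>0 (A.f j)) * uinv c\<^sub>0"
    unfolding c[OF assms(2)] by (simp add: uinv_mult mult.assoc)
  then have c': "uinv (B.f (\<pi> j)) * uinv (\<phi>' (p j)) = p (\<sigma> j) * uinv (\<psi>\<^sub>0 (A.f j)) * uinv c\<^sub>0"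
    by (simp add: uinv_mult)
  have "uinv (B.f (\<pi> j)) * \<phi>' (\<theta> i j x) * B.f (\<pi> i)
      = (uinv (B.f (\<pi> j)) * uinv (\<phi>' (p j))) * (c\<^sub>0 * \<psi>\<^sub>0 (\<phi> x) * uinv c\<^sub>0)
        * (\<phi>' (p i) * B.f (\<pi> i))"
    by (simp add: \<theta>_def B.phi_mult B.phi_uinv twist mult.assoc)
  also have "\<dots> = p (\<sigma> j) * uinv (\<psi>\<^sub>0 (A.f j)) * \<psi>\<^sub>0 (\<phi> x) * \<psi>\<^sub>0 (A.f i) * uinv (p (\<sigma> i))"
    unfolding c' c[OF assms(1)] by (simp add: mult.assoc)
  finally show ?thesis by (simp add: \<theta>_def psi_mult psi_uinv mult.assoc)
qed

lemma theta_deg_cong: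
  assumes "x \<in> U" "y \<in> U" "deg x = deg y"
  shows "deg (\<theta> i j x) = deg (\<theta> i j y)"
  using assms psi_deg_cong[OF assms] by (simp add: \<theta>_def)

lemma theta_deg_diag: "x \<in> U \<Longrightarrow> deg (\<theta> i i x) = deg (\<psi>\<^sub>0 x)"
  by (simp add: \<theta>_def deg_conj del: deg_mult)

lemma theta_deg_eqD:
  assumes "x \<in> U" "y \<in> U" "deg y = deg (\<theta> i j x)"
  obtains z where "z \<in> U" "\<theta> i j z = y" "deg z = deg x"
proof -
  let ?y = "uinv (p i) * y * p j"
  have "deg ?y = deg (uinv (p i) * \<theta> i j x * p j)" using assms by (intro deg_conj_cong) simp_all
  then have "deg ?y = deg (\<psi>\<^sub>0 x)" using assms by (simp add: \<theta>_def mult.assoc del: deg_mult)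
  then obtain z where "z \<in> U" "\<psi>\<^sub>0 z = ?y" "deg z = deg x"
    using psi_deg_eqD[of x ?y] assms by auto
  moreover from this have "\<theta> i j z = y" by (simp add: \<theta>_def mult.assoc)
  ultimately show ?thesis using that by blast
qed

text \<open>Each way in which two degrees can agree in R becomes the same way in R'. On the
  diagonal, conjugation by p_i preserves degrees because the support is abelian; for exchanged
  positions \<open>theta_involution\<close> identifies the coefficients.\<close>

lemma hdeg_transport:
  assumes "i < n" "j < n" "i' < n" "j' < n" "x \<in> U" "y \<in> U" "A.hdeg i j x = A.hdeg i' j' y"
  shows "B.hdeg (\<pi> i) (\<pi> j) (\<theta> i j x) = B.hdeg (\<pi> i') (\<pi> j') (\<theta> i' j' y)"
proof -
  have "i = j \<and> i' = j' \<and> deg x = deg y \<or> i = i' \<and> j = j' \<and> deg x = deg y \<or>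
    i \<noteq> j \<and> i' = \<sigma> j \<and> j' = \<sigma> i \<and> deg y = deg (uinv (A.f j) * \<phi> x * A.f i)"
    using iffD1[OF A.hdeg_eq_iff[OF assms(1-6)] assms(7)] .
  then consider "i = j" "i' = j'" "deg x = deg y" | "i = i'" "j = j'" "deg x = deg y"
    | "i \<noteq> j" "i' = \<sigma> j" "j' = \<sigma> i" "deg y = deg (uinv (A.f j) * \<phi> x * A.f i)" by blast
  then show ?thesis
  proof cases
    case 1
    then show ?thesis
      using assms theta_deg_diag psi_deg_cong[of x y]
      by (simp only:) (intro B.hdeg_diag, simp_all)
  next
    case 2
    then show ?thesis
      using assms theta_deg_cong[of x y i j] by (simp add: B.hdeg_def)
  next
    case 3
    have "deg (\<theta> i' j' y) = deg (\<theta> i' j' (uinv (A.f j) * \<phi> x * A.f i))"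
      using assms 3 by (intro theta_deg_cong) auto
    also have "\<dots> = deg (uinv (B.f (\<pi> j)) * \<phi>' (\<theta> i j x) * B.f (\<pi> i))"
      using theta_involution[OF assms(1,2), of x] 3 by simp
    finally have "B.hdeg (\<pi> i) (\<pi> j) (\<theta> i j x) = B.hdeg (\<sigma> (\<pi> j)) (\<sigma> (\<pi> i)) (\<theta> i' j' y)"
      using assms 3 by (intro B.hdeg_swap) simp_all
    then show ?thesis using 3 by (simp add: pi_mate)
  qed
qed

text \<open>The converse starts from an entry \<open>y\<close> of R'. It is what makes the image of
  a component a full component and not just a part of one.\<close>

lemma hdeg_transport_inv:
  assumes "i < n" "j < n" "i' < n" "j' < n" "x \<in> U" "y \<in> U"
    and eq: "B.hdeg (\<pi> i) (\<pi> j) (\<theta> i j x) = B.hdeg (\<pi> i') (\<pi> j') y"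
  obtains z where "z \<in> U" "\<theta> i' j' z = y" "A.hdeg i j x = A.hdeg i' j' z"
proof -
  have "\<pi> i = \<pi> j \<and> \<pi> i' = \<pi> j' \<and> deg (\<theta> i j x) = deg y \<or>
    \<pi> i = \<pi> i' \<and> \<pi> j = \<pi> j' \<and> deg (\<theta> i j x) = deg y \<or>
    \<pi> i \<noteq> \<pi> j \<and> \<pi> i' = \<sigma> (\<pi> j) \<and> \<pi> j' = \<sigma> (\<pi> i) \<and>
    deg y = deg (uinv (B.f (\<pi> j)) * \<phi>' (\<theta> i j x) * B.f (\<pi> i))"
    using iffD1[OF B.hdeg_eq_iff eq] assms by simp
  then consider "i = j" "i' = j'" "deg (\<theta> i j x) = deg y" | "i = i'" "j = j'" "deg (\<theta> i j x) = deg y"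
    | "i \<noteq> j" "i' = \<sigma> j" "j' = \<sigma> i"
      "deg y = deg (\<theta> (\<sigma> j) (\<sigma> i) (uinv (A.f j) * \<phi> x * A.f i))"
    using theta_involution[OF assms(1,2), of x] by (auto simp flip: pi_mate)
  then show ?thesis
  proof cases
    case 1
    then have "deg y = deg (\<theta> i' j' x)" using assms theta_deg_diag by metis
    then obtain z where z: "z \<in> U" "\<theta> i' j' z = y" "deg z = deg x"
      using theta_deg_eqD assms by blast
    then have "A.hdeg i j x = A.hdeg i' j' z" using 1 assms by (metis A.hdeg_diag)
    then show ?thesis using that z by blast
  next
    case 2
    then have "deg y = deg (\<theta> i' j' x)" by simp
    then obtain z where z: "z \<in> U" "\<theta> i' j' z = y" "deg z = deg x"
      using theta_deg_eqD assms by blast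
    then have "A.hdeg i j x = A.hdeg i' j' z" using 2 by (simp add: A.hdeg_def)
    then show ?thesis using that z by blast
  next
    case 3
    then obtain z where z: "z \<in> U" "\<theta> i' j' z = y" "deg z = deg (uinv (A.f j) * \<phi> x * A.f i)"
      using theta_deg_eqD[of "uinv (A.f j) * \<phi> x * A.f i" y i' j'] assms by auto
    then have "A.hdeg i j x = A.hdeg i' j' z" using 3 assms A.hdeg_swap[of i j x z] by metis
    then show ?thesis using that z by blast
  qed
qed

definition \<Psi> :: "'d mat \<Rightarrow> 'd mat"
  where "\<Psi> X = mat n n (\<lambda>(a, b). \<theta> (\<rho> a) (\<rho> b) (X $$ (\<rho> a, \<rho> b)))"

lemma Psi_carrier [simp]: "\<Psi> X \<in> carrier_mat n n"
  by (simp add: \<Psi>_def)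

lemma Psi_index [simp]: "a < n \<Longrightarrow> b < n \<Longrightarrow> \<Psi> X $$ (a, b) = \<theta> (\<rho> a) (\<rho> b) (X $$ (\<rho> a, \<rho> b))"
  by (simp add: \<Psi>_def)

lemma Psi_index_pi: "i < n \<Longrightarrow> j < n \<Longrightarrow> \<Psi> X $$ (\<pi> i, \<pi> j) = \<theta> i j (X $$ (i, j))"
  by simp

lemma bij_theta: "bij (\<theta> i j)"
proof (rule bijI)
  show "inj (\<theta> i j)"
  proof (rule injI)
    fix x y assume "\<theta> i j x = \<theta> i j y"
    moreover have "\<psi>\<^sub>0 z = uinv (p i) * \<theta> i j z * p j" for z by (simp add: \<theta>_def mult.assoc)
    ultimately show "x = y" using bij_is_inj[OF bij_psi] by (metis injD)
  qed
  show "surj (\<theta> i j)"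
  proof
    show "UNIV \<subseteq> range (\<theta> i j)"
    proof
      fix y
      obtain x where "\<psi>\<^sub>0 x = uinv (p i) * y * p j" using bij_is_surj[OF bij_psi] by (metis surjD)
      then have "\<theta> i j x = y" by (simp add: \<theta>_def mult.assoc)
      then show "y \<in> range (\<theta> i j)" by blast
    qed
  qed simp
qed

lemma Psi_surj:
  assumes "Y \<in> carrier_mat n n"
  obtains X where "X \<in> carrier_mat n n" "\<Psi> X = Y"
proof
  let ?X = "mat n n (\<lambda>(i, j). inv_into UNIV (\<theta> i j) (Y $$ (\<pi> i, \<pi> j)))"
  show "?X \<in> carrier_mat n n" by simp
  show "\<Psi> ?X = Y"
    using assms bij_is_surj[OF bij_theta]
    by (intro eq_matI) (auto simp: surj_f_inv_f \<Psi>_def)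
qed

lemma Psi_inj:
  assumes "X \<in> carrier_mat n n" "Y \<in> carrier_mat n n" "\<Psi> X = \<Psi> Y"
  shows "X = Y"
proof (rule eq_matI)
  fix i j assume "i < dim_row Y" "j < dim_col Y"
  then have "i < n" "j < n" using assms by auto
  then have "\<theta> i j (X $$ (i, j)) = \<theta> i j (Y $$ (i, j))" using assms(3) Psi_index_pi by metis
  then show "X $$ (i, j) = Y $$ (i, j)" using bij_is_inj[OF bij_theta] by (metis injD)
qed (use assms in auto)

lemma Psi_mult:
  assumes "X \<in> carrier_mat n n" "Y \<in> carrier_mat n n"
  shows "\<Psi> (X * Y) = \<Psi> X * \<Psi> Y"
proof (rule eq_matI)
  fix a b assume "a < dim_row (\<Psi> X * \<Psi> Y)" "b < dim_col (\<Psi> X * \<Psi> Y)"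
  then have ab: "a < n" "b < n" by (auto simp: \<Psi>_def)
  let ?g = "\<lambda>c. \<theta> (\<rho> a) c (X $$ (\<rho> a, c)) * \<theta> c (\<rho> b) (Y $$ (c, \<rho> b))"
  have th: "\<theta> i c x * \<theta> c j y = \<theta> i j (x * y)" for i c j x y
    by (simp add: \<theta>_def psi_mult mult.assoc)
  have "(\<Psi> X * \<Psi> Y) $$ (a, b) = (\<Sum>c<n. ?g (\<rho> c))"
    using ab by (subst index_mult_mat_sum[of _ n n _ n]) auto
  also have "\<dots> = (\<Sum>c<n. ?g c)"
    by (rule sum.reindex_bij_witness[of _ \<pi> \<rho>]) auto
  also have "\<dots> = \<theta> (\<rho> a) (\<rho> b) (\<Sum>c<n. X $$ (\<rho> a, c) * Y $$ (c, \<rho> b))"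
    by (simp add: th) (simp add: \<theta>_def psi_sum sum_distrib_left sum_distrib_right)
  also have "\<dots> = \<Psi> (X * Y) $$ (a, b)"
    using ab assms by (simp add: index_mult_mat_sum[OF assms] del: index_mult_mat(1))
  finally show "\<Psi> (X * Y) $$ (a, b) = (\<Psi> X * \<Psi> Y) $$ (a, b)" by simp
qed (auto simp: \<Psi>_def)

lemma Psi_add:
  assumes "X \<in> carrier_mat n n" "Y \<in> carrier_mat n n"
  shows "\<Psi> (X + Y) = \<Psi> X + \<Psi> Y"
  using assms by (intro eq_matI) (auto simp: \<Psi>_def \<theta>_def psi_add distrib_left distrib_right)

lemma Psi_one: "\<Psi> (1\<^sub>m n) = 1\<^sub>m n"
  by (rule eq_matI) (auto simp: \<Psi>_def \<theta>_def, metis pi_rho(1))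

lemma Psi_scale:
  assumes "X \<in> carrier_mat n n"
  shows "\<Psi> (map_mat (scale a) X) = map_mat (scale a) (\<Psi> X)"
  using assms by (intro eq_matI) (auto simp: \<Psi>_def \<theta>_def psi_scale scale_mult_left scale_mult_right)

lemma Psi_involution:
  assumes "X \<in> carrier_mat n n"
  shows "\<Psi> (involution A.R X) = involution B.R (\<Psi> X)"
proof (rule eq_matI)
  have c: "involution B.R (\<Psi> X) \<in> carrier_mat n n"
    using B.involution_index(2)[OF Psi_carrier[of X], of 0 0] B.n_pos by simp
  then show "dim_row (\<Psi> (involution A.R X)) = dim_row (involution B.R (\<Psi> X))"
    "dim_col (\<Psi> (involution A.R X)) = dim_col (involution B.R (\<Psi> X))" by (auto simp: \<Psi>_def)
  fix a b assume "a < dim_row (involution B.R (\<Psi> X))" "b < dim_col (involution B.R (\<Psi> X))"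
  then have ab: "a < n" "b < n" using c by auto
  define j where "j = \<sigma> (\<rho> a)"
  define i where "i = \<sigma> (\<rho> b)"
  have ij: "i < n" "j < n" "\<rho> a = \<sigma> j" "\<rho> b = \<sigma> i" "\<sigma> a = \<pi> j" "\<sigma> b = \<pi> i"
    using ab by (auto simp: i_def j_def sigma_less pi_mate)
  have "\<Psi> (involution A.R X) $$ (a, b)
      = \<theta> (\<sigma> j) (\<sigma> i) (uinv (A.f j) * \<phi> (X $$ (i, j)) * A.f i)"
    using ab ij sigma_less by (simp add: A.involution_index[OF assms])
  also have "\<dots> = uinv (B.f (\<pi> j)) * \<phi>' (\<theta> i j (X $$ (i, j))) * B.f (\<pi> i)"
    using theta_involution ij by simp
  also have "\<dots> = involution B.R (\<Psi> X) $$ (a, b)"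
    using ab ij by (simp add: B.involution_index[OF Psi_carrier])
  finally show "\<Psi> (involution A.R X) $$ (a, b) = involution B.R (\<Psi> X) $$ (a, b)" .
qed

text \<open>A nonzero entry of some element of the component determines its degree, and the image of
  this entry determines the degree of the target.\<close>

lemma Psi_component:
  assumes "component A.R \<gamma> \<noteq> {0\<^sub>m n n}"
  obtains \<gamma>' where "\<gamma>' \<in> carrier (grading_group B.R)" "\<Psi> ` component A.R \<gamma> = component B.R \<gamma>'"
proof -
  have "0\<^sub>m n n \<in> component A.R \<gamma>" by (simp add: A.component_iff)
  then obtain X0 where X0: "X0 \<in> component A.R \<gamma>" "X0 \<noteq> 0\<^sub>m n n" using assms by blast
  then have "\<exists>i<n. \<exists>j<n. X0 $$ (i, j) \<noteq> 0"
    by (metis A.component_iff carrier_matD eq_matI index_zero_mat)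
  then obtain i0 j0 where ij0: "i0 < n" "j0 < n" "X0 $$ (i0, j0) \<noteq> 0" by blast
  define x where "x = X0 $$ (i0, j0)"
  have x: "x \<in> U" "\<gamma> = A.hdeg i0 j0 x" using X0(1) ij0 by (auto simp: A.component_iff x_def)
  let ?\<gamma>' = "B.hdeg (\<pi> i0) (\<pi> j0) (\<theta> i0 j0 x)"
  have "\<Psi> ` component A.R \<gamma> = component B.R ?\<gamma>'"
  proof (intro subset_antisym subsetI)
    fix Y assume "Y \<in> \<Psi> ` component A.R \<gamma>"
    then obtain X where X: "X \<in> component A.R \<gamma>" "Y = \<Psi> X" by blast
    have "\<Psi> X $$ (a, b) \<in> U \<and> B.hdeg a b (\<Psi> X $$ (a, b)) = ?\<gamma>'"
      if ab: "a < n" "b < n" "\<Psi> X $$ (a, b) \<noteq> 0" for a b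
    proof -
      have r: "\<rho> a < n" "\<rho> b < n" using ab by auto
      have "X $$ (\<rho> a, \<rho> b) \<noteq> 0" using ab by simp
      then have "X $$ (\<rho> a, \<rho> b) \<in> U" "A.hdeg (\<rho> a) (\<rho> b) (X $$ (\<rho> a, \<rho> b)) = \<gamma>"
        using X(1) r unfolding A.component_iff by blast+
      then show ?thesis
        using hdeg_transport[OF r ij0(1,2) _ x(1)] x(2) ab by simp
    qed
    then show "Y \<in> component B.R ?\<gamma>'" by (simp add: X(2) B.component_iff)
  next
    fix Y assume Y: "Y \<in> component B.R ?\<gamma>'"
    then have "Y \<in> carrier_mat n n" by (simp add: B.component_iff)
    then obtain X where X: "X \<in> carrier_mat n n" "\<Psi> X = Y" by (rule Psi_surj)
    have "X $$ (i, j) \<in> U \<and> A.hdeg i j (X $$ (i, j)) = \<gamma>"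
      if ij: "i < n" "j < n" "X $$ (i, j) \<noteq> 0" for i j
    proof -
      let ?y = "Y $$ (\<pi> i, \<pi> j)"
      have y: "?y = \<theta> i j (X $$ (i, j))" using X(2) Psi_index_pi ij by metis
      then have "?y \<noteq> 0" using ij by simp
      then have "?y \<in> U" "?\<gamma>' = B.hdeg (\<pi> i) (\<pi> j) ?y" using Y ij unfolding B.component_iff by auto
      then obtain z where "z \<in> U" "\<theta> i j z = ?y" "A.hdeg i0 j0 x = A.hdeg i j z"
        using hdeg_transport_inv[OF ij0(1,2) ij(1,2) x(1)] by blast
      moreover have "z = X $$ (i, j)"
        using calculation y bij_is_inj[OF bij_theta, of i j] by (metis injD)
      ultimately show ?thesis using x by simp
    qed
    then have "X \<in> component A.R \<gamma>" using X by (simp add: A.component_iff)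
    then show "Y \<in> \<Psi> ` component A.R \<gamma>" using X by blast
  qed
  moreover have "?\<gamma>' \<in> carrier (grading_group B.R)" using B.hdeg_carrier ij0 x by simp
  ultimately show ?thesis using that by blast
qed

lemma graded_inv_equivalence_Psi: "graded_inv_equivalence A.R B.R \<Psi>"
  unfolding graded_inv_equivalence_def graded_equivalence_def
proof (intro conjI ballI allI impI)
  have "bij_betw \<Psi> (carrier_mat n n) (carrier_mat n n)"
  proof (rule bij_betwI')
    show "\<exists>X\<in>carrier_mat n n. Y = \<Psi> X" if "Y \<in> carrier_mat n n" for Y
      using Psi_surj[OF that] by metis
  qed (use Psi_inj in auto)
  then show "\<Psi> \<in> ring_iso A.R B.R"
    by (auto simp: ring_iso_def ring_hom_def Psi_mult Psi_add Psi_one)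
  show "\<exists>h\<in>carrier (grading_group B.R). \<Psi> ` component A.R g = component B.R h"
    if "component A.R g \<noteq> {\<zero>\<^bsub>A.R\<^esub>}" for g
    using that Psi_component[of g] by (metis A.R_simps(4))
qed (auto simp: Psi_scale Psi_involution)

end

locale M_same_shape = comm_graded_division_algebra scale G Dc +
  A: M_algebra scale G Dc \<phi> q s d \<delta> + B: M_algebra scale G Dc \<phi>' q s d' \<delta>'
  for scale :: "'f::field \<Rightarrow> 'd::ring_1 \<Rightarrow> 'd" and G :: "'g monoid" (structure) and Dc
    and \<phi> q s d \<delta> \<phi>' d' \<delta>'
begin

lemma graded_inv_equivalentI:
  assumes "graded_automorphism \<psi>\<^sub>0" and c0 [simp]: "c\<^sub>0 \<in> U"
    and \<phi>': "\<phi>' = Int_aut (alg_of scale G Dc) c\<^sub>0 \<circ> (\<psi>\<^sub>0 \<circ> \<phi> \<circ> inv_into UNIV \<psi>\<^sub>0)"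
    and \<phi>'c0: "\<phi>' c\<^sub>0 = scale (\<delta> * \<delta>') c\<^sub>0"
    and c: "length c = q" "set c \<subseteq> U"
    and d': "mset d' = mset (map (\<lambda>i. c\<^sub>0 * \<psi>\<^sub>0 (c ! i * d ! i * \<phi> (c ! i))) [0..<q])"
  shows "graded_inv_equivalent A.R B.R"
proof -
  interpret comm_graded_automorphism scale G Dc \<psi>\<^sub>0 by unfold_locales fact
  obtain \<pi> where \<pi>: "\<pi> permutes {..<length d'}"
    "permute_list \<pi> d' = map (\<lambda>i. c\<^sub>0 * \<psi>\<^sub>0 (c ! i * d ! i * \<phi> (c ! i))) [0..<q]"
    using mset_eq_permutation[OF d'[symmetric]] by metis
  have \<pi>q: "\<pi> permutes {..<q}" using \<pi>(1) B.length_d by simp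
  have d'_nth: "d' ! \<pi> i = c\<^sub>0 * \<psi>\<^sub>0 (c ! i * d ! i * \<phi> (c ! i))" if "i < q" for i
    using permute_list_nth[OF \<pi>(1), of i] that B.length_d unfolding \<pi>(2) by simp
  \<comment> \<open>These values solve \<open>form\<close>. On the diagonal, \<open>twist\<close>
    gives phi'(p_i) = c_0 psi_0(c_i)^{-1} c_0^{-1}, which removes c_i from the left of d'_{pi i},
    while p_i removes phi(c_i) from the right. On a hyperbolic pair the values 1 and c_0 make the
    first row trivial.\<close>
  define p where "p i = (if i < q then uinv (\<psi>\<^sub>0 (\<phi> (c ! i))) else if even (i - q) then 1 else c\<^sub>0)" for i
  have cU [simp]: "c ! i \<in> U" if "i < q" for i using c that by auto
  have dU [simp]: "d ! i \<in> U" if "i < q" for i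
    using A.f_unit[of i] that by (simp add: A.f_def phi_coeff_def A.length_d)
  have twist: "\<phi>' (\<psi>\<^sub>0 x) = c\<^sub>0 * \<psi>\<^sub>0 (\<phi> x) * uinv c\<^sub>0" for x
    using bij_is_inj[OF bij_psi] by (subst \<phi>') (simp add: Int_aut_unit)
  have M: "M_transport scale G Dc \<phi> q s d \<delta> \<phi>' d' \<delta>' \<psi>\<^sub>0 p \<pi> c\<^sub>0"
  proof unfold_locales
    show "p i \<in> U" for i by (simp add: p_def)
    show "\<phi>' (p i) * B.f (\<pi> i) * p (mate q i) = c\<^sub>0 * \<psi>\<^sub>0 (A.f i)" if "i < q + 2 * s" for i
    proof (cases "i < q")
      case True
      then have "\<pi> i < q" using permutes_in_image[OF \<pi>q, of i] by simp
      then have "B.f (\<pi> i) = c\<^sub>0 * \<psi>\<^sub>0 (c ! i * d ! i * \<phi> (c ! i))" "A.f i = d ! i" "mate q i = i"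
        using True d'_nth
        by (simp_all add: A.f_def B.f_def phi_coeff_def A.length_d B.length_d mate_fixed_iff)
      moreover have "\<phi>' (p i) = c\<^sub>0 * uinv (\<psi>\<^sub>0 (c ! i)) * uinv c\<^sub>0"
        using True by (simp add: p_def B.phi_uinv twist uinv_mult mult.assoc)
      ultimately show ?thesis
        using True by (simp add: p_def psi_mult mult.assoc)
    next
      case False
      then have "\<pi> i = i" using permutes_not_in[OF \<pi>q, of i] by simp
      have m: "\<not> mate q i < q" "even (mate q i - q) \<longleftrightarrow> odd (i - q)"
        using False by (auto simp: mate_def) presburger+
      \<comment> \<open>The second row of a hyperbolic pair; condition (ii) and delta'^2 = 1 enter
        here.\<close>
      have "\<phi>' c\<^sub>0 * B.eps = c\<^sub>0 * \<psi>\<^sub>0 A.eps"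
      proof -
        have "\<phi>' c\<^sub>0 = A.eps * (B.eps * c\<^sub>0)"
          unfolding \<phi>'c0 by (simp flip: A.scale_delta B.scale_delta)
        then have "\<phi>' c\<^sub>0 * B.eps = A.eps * (B.eps * (B.eps * c\<^sub>0))"
          by (simp only: mult.assoc B.eps_commute[of c\<^sub>0])
        moreover have "\<psi>\<^sub>0 A.eps = A.eps" by (simp add: A.eps_def psi_scale)
        ultimately show ?thesis by (simp add: A.eps_commute)
      qed
      then show ?thesis
        using False m \<open>\<pi> i = i\<close>
        by (simp add: p_def A.f_def B.f_def phi_coeff_def A.length_d B.length_d
            flip: A.eps_def B.eps_def)
    qed
  qed (use \<pi>q twist in auto)
  then show ?thesis
    using M_transport.graded_inv_equivalence_Psi[OF M] by (auto simp: graded_inv_equivalent_def)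
qed

end

text \<open>By definition components go to components, but a component of the target could a priori
  be missed. The homogeneous parts of a preimage of \<open>y\<close> are sent to pairwise distinct
  degrees, since \<open>\<psi>\<close> is injective, so their images form the decomposition of
  \<open>y\<close>; this has a single term.\<close>

lemma (in comm_graded_automorphism) psi_unit_preimage:
  assumes "y \<in> U"
  obtains x where "x \<in> U" "\<psi> x = y"
proof -
  obtain x where x: "\<psi> x = y" using bij_is_surj[OF bij_psi] by (metis surjD)
  obtain f where f: "\<forall>g\<in>carrier G. f g \<in> Dc g" "\<forall>g. g \<notin> carrier G \<longrightarrow> f g = 0"
    "finite {g. f g \<noteq> 0}" "x = (\<Sum>g | f g \<noteq> 0. f g)"
    using direct_sum[of x] by blast
  let ?S = "{g. f g \<noteq> 0}"
  define k where "k g = deg (\<psi> (f g))" for g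
  have U: "f g \<in> U" "deg (f g) = g" if "g \<in> ?S" for g
    using that f gr_unitI deg_eqI by (metis mem_Collect_eq)+
  have inj: "inj_on k ?S"
  proof (rule inj_onI)
    fix g h assume "g \<in> ?S" "h \<in> ?S" "k g = k h"
    then obtain z where "\<psi> z = \<psi> (f h)" "deg z = deg (f g)"
      using psi_deg_eqD[of "f g" "\<psi> (f h)"] U by (metis k_def psi_unit)
    then show "g = h" using U \<open>g \<in> ?S\<close> \<open>h \<in> ?S\<close> bij_is_inj[OF bij_psi] by (metis injD)
  qed
  have kG: "k g \<in> carrier G" "\<psi> (f g) \<in> Dc (k g)" if "g \<in> ?S" for g
    using U(1)[OF that] Dc_deg[of "\<psi> (f g)"] deg_in_support[of "\<psi> (f g)"]
    by (auto simp: k_def gr_support_def)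
  let ?f = "\<lambda>h. if h \<in> k ` ?S then \<psi> (f (the_inv_into ?S k h)) else 0"
  have fk: "?f (k g) = \<psi> (f g)" if "g \<in> ?S" for g
    using that the_inv_into_f_f[OF inj that] by simp
  have ne: "{h. ?f h \<noteq> 0} = k ` ?S"
  proof (intro subset_antisym subsetI)
    fix h assume "h \<in> k ` ?S"
    then obtain g where "g \<in> ?S" "h = k g" by blast
    then have "?f h = \<psi> (f g)" "f g \<noteq> 0" using fk by blast+
    then show "h \<in> {h. ?f h \<noteq> 0}" by simp
  qed (auto split: if_splits)
  have "(\<Sum>h | ?f h \<noteq> 0. ?f h) = (\<Sum>g\<in>?S. ?f (k g))"
    unfolding ne by (simp add: sum.reindex[OF inj] comp_def)
  also have "\<dots> = (\<Sum>g\<in>?S. \<psi> (f g))" by (rule sum.cong[OF refl]) (rule fk)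
  also have "\<dots> = y" using x f(4) psi_sum by metis
  finally have s: "(\<Sum>h | ?f h \<noteq> 0. ?f h) = y" .
  have fD: "?f h \<in> Dc h" if "h \<in> carrier G" for h
  proof (cases "h \<in> k ` ?S")
    case True
    then obtain g where g: "g \<in> ?S" "h = k g" by blast
    show ?thesis unfolding g(2) fk[OF g(1)] by (rule kG(2)[OF g(1)])
  qed (use that zero_Dc in simp)
  have dy: "deg y \<in> carrier G" using deg_in_support[OF assms] by (simp add: gr_support_def)
  have z: "?f h = 0" if "h \<noteq> deg y" for h
    using that s fD kG(1) f(3) dy Dc_deg[OF assms]
    by (intro single_decomposition_unique[of ?f "deg y" h]) (auto simp: ne)
  have kd: "k g = deg y" if "g \<in> ?S" for g
    using z[of "k g"] fk[OF that] that by auto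
  have "?S \<subseteq> {g}" if "g \<in> ?S" for g
    using inj_onD[OF inj _ _ that] kd that by (metis singletonI subsetI)
  moreover have "?S \<noteq> {}" using f(4) x assms unit_nonzero psi_zero by (metis sum.empty)
  ultimately obtain g where "?S = {g}" by blast
  then have "x = f g" "g \<in> ?S" using f(4) by auto
  then show ?thesis using that U x by blast
qed

section \<open>The structure of an equivalence\<close>

definition mat_unit :: "nat \<Rightarrow> nat \<Rightarrow> nat \<Rightarrow> 'a::zero \<Rightarrow> 'a mat"
  where "mat_unit n i j x = mat n n (\<lambda>(a, b). if a = i \<and> b = j then x else 0)"

lemma mat_unit_carrier [simp]: "mat_unit n i j x \<in> carrier_mat n n"
  by (simp add: mat_unit_def)

lemma mat_unit_index [simp]:
  "\<lbrakk>a < n; b < n\<rbrakk> \<Longrightarrow> mat_unit n i j x $$ (a, b) = (if a = i \<and> b = j then x else 0)"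
  by (simp add: mat_unit_def)

lemma mat_unit_eq_iff: "\<lbrakk>i < n; j < n\<rbrakk> \<Longrightarrow> mat_unit n i j x = mat_unit n i j y \<longleftrightarrow> x = y"
  using mat_unit_index[of i n j i j] by metis

lemma mat_unit_mult_index:
  fixes X :: "'a::semiring_0 mat"
  assumes "X \<in> carrier_mat n n" "j < n" "a < n" "b < n"
  shows "(mat_unit n i j x * X) $$ (a, b) = (if a = i then x * X $$ (j, b) else 0)"
proof -
  have "(mat_unit n i j x * X) $$ (a, b) = (\<Sum>c<n. if c = j then (if a = i then x * X $$ (j, b) else 0) else 0)"
    unfolding index_mult_mat_sum[OF mat_unit_carrier assms(1,3,4)]
    using assms by (intro sum.cong) auto
  then show ?thesis using assms by simp
qed

lemma mult_mat_unit_index: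
  fixes X :: "'a::semiring_0 mat"
  assumes "X \<in> carrier_mat n n" "i < n" "a < n" "b < n"
  shows "(X * mat_unit n i j x) $$ (a, b) = (if b = j then X $$ (a, i) * x else 0)"
proof -
  have "(X * mat_unit n i j x) $$ (a, b) = (\<Sum>c<n. if c = i then (if b = j then X $$ (a, i) * x else 0) else 0)"
    unfolding index_mult_mat_sum[OF assms(1) mat_unit_carrier assms(3,4)]
    using assms by (intro sum.cong) auto
  then show ?thesis using assms by simp
qed

lemma mat_unit_mult_mat_unit:
  fixes x y :: "'a::semiring_0"
  assumes "j < n"
  shows "mat_unit n i j x * mat_unit n j l y = mat_unit n i l (x * y)"
proof (rule eq_matI)
  fix a b assume "a < dim_row (mat_unit n i l (x * y))" "b < dim_col (mat_unit n i l (x * y))"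
  then have "a < n" "b < n" by (auto simp: mat_unit_def)
  then show "(mat_unit n i j x * mat_unit n j l y) $$ (a, b) = mat_unit n i l (x * y) $$ (a, b)"
    using assms by (simp add: mat_unit_mult_index del: index_mult_mat(1))
qed (auto simp: mat_unit_def)

lemma mat_unit_sandwich:
  fixes X :: "'a::semiring_1 mat"
  assumes "X \<in> carrier_mat n n" "i < n" "j < n"
  shows "mat_unit n i i 1 * X * mat_unit n j j 1 = mat_unit n i j (X $$ (i, j))"
proof (rule eq_matI)
  have c: "mat_unit n i i 1 * X \<in> carrier_mat n n" using mult_carrier_mat[OF mat_unit_carrier assms(1)] .
  fix a b assume "a < dim_row (mat_unit n i j (X $$ (i, j)))" "b < dim_col (mat_unit n i j (X $$ (i, j)))"
  then have ab: "a < n" "b < n" by (auto simp: mat_unit_def)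
  then show "(mat_unit n i i 1 * X * mat_unit n j j 1) $$ (a, b) = mat_unit n i j (X $$ (i, j)) $$ (a, b)"
    using assms by (simp add: mult_mat_unit_index[OF c] mat_unit_mult_index[OF assms(1)] del: index_mult_mat(1))
qed (auto simp: mat_unit_def)

lemma mat_unit_add:
  fixes x y :: "'a::monoid_add"
  shows "mat_unit n i j x + mat_unit n i j y = mat_unit n i j (x + y)"
  by (rule eq_matI) (auto simp: mat_unit_def)

lemma mat_unit_mult_diagonal:
  fixes X :: "'a::semiring_1 mat"
  assumes "X \<in> carrier_mat n n" "i < n" "\<And>a b. \<lbrakk>a < n; b < n; a \<noteq> b\<rbrakk> \<Longrightarrow> X $$ (a, b) = 0" "X $$ (i, i) = 1"
  shows "mat_unit n i i 1 * X = mat_unit n i i 1" "X * mat_unit n i i 1 = mat_unit n i i 1"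
proof -
  have "(mat_unit n i i 1 * X) $$ (a, b) = mat_unit n i i 1 $$ (a, b)"
    "(X * mat_unit n i i 1) $$ (a, b) = mat_unit n i i 1 $$ (a, b)" if "a < n" "b < n" for a b
    using assms that by (auto simp: mat_unit_mult_index mult_mat_unit_index simp del: index_mult_mat(1))
  then show "mat_unit n i i 1 * X = mat_unit n i i 1" "X * mat_unit n i i 1 = mat_unit n i i 1"
    using assms(1) by (auto intro!: eq_matI simp: mat_unit_def simp del: index_mult_mat(1))
qed

context M_algebra
begin

lemma mat_unit_component_iff:
  assumes "i < n" "j < n"
  shows "mat_unit n i j x \<in> component R \<gamma> \<longleftrightarrow> x = 0 \<or> x \<in> U \<and> hdeg i j x = \<gamma>"
  using assms by (auto simp: component_iff)

lemma involution_mat_unit: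
  assumes "i < n" "j < n"
  shows "involution R (mat_unit n i j x) = mat_unit n (\<sigma> j) (\<sigma> i) (uinv (f j) * \<phi> x * f i)"
proof (rule eq_matI)
  have c: "involution R (mat_unit n i j x) \<in> carrier_mat n n"
    using involution_index(2)[OF mat_unit_carrier assms] .
  then show "dim_row (involution R (mat_unit n i j x)) = dim_row (mat_unit n (\<sigma> j) (\<sigma> i) (uinv (f j) * \<phi> x * f i))"
    "dim_col (involution R (mat_unit n i j x)) = dim_col (mat_unit n (\<sigma> j) (\<sigma> i) (uinv (f j) * \<phi> x * f i))"
    by (auto simp: mat_unit_def)
  fix a b assume "a < dim_row (mat_unit n (\<sigma> j) (\<sigma> i) (uinv (f j) * \<phi> x * f i))"
    "b < dim_col (mat_unit n (\<sigma> j) (\<sigma> i) (uinv (f j) * \<phi> x * f i))"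
  then have ab: "a < n" "b < n" by (auto simp: mat_unit_def)
  have "\<sigma> b = i \<longleftrightarrow> b = \<sigma> i" "\<sigma> a = j \<longleftrightarrow> a = \<sigma> j" by auto
  then show "involution R (mat_unit n i j x) $$ (a, b)
      = mat_unit n (\<sigma> j) (\<sigma> i) (uinv (f j) * \<phi> x * f i) $$ (a, b)"
    using ab mate_less[of a q s] mate_less[of b q s]
    by (simp add: involution_index[OF mat_unit_carrier])
qed

text \<open>The neutral element of the grading group, written as the degree of E_00; index 0 exists
  by \<open>n_pos\<close>.\<close>

abbreviation "identity_component \<equiv> component R (hdeg 0 0 1)"

lemma identity_componentD:
  assumes "X \<in> identity_component" "i < n" "j < n" "X $$ (i, j) \<noteq> 0"
  shows "i = j" "X $$ (i, j) \<in> U"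
proof -
  have u: "X $$ (i, j) \<in> U" "hdeg i j (X $$ (i, j)) = hdeg 0 0 1"
    using assms unfolding component_iff by blast+
  then show "X $$ (i, j) \<in> U" by simp
  \<comment> \<open>Off the diagonal, equality with the degree of E_00 would require both mates to
    be 0.\<close>
  show "i = j"
    using iffD1[OF hdeg_eq_iff[OF assms(2,3) n_pos n_pos u(1) one_in_units] u(2)] by (metis mate_eq_iff)
qed

lemma mat_unit_in_identity_component: "i < n \<Longrightarrow> mat_unit n i i 1 \<in> identity_component"
  using hdeg_diag[of i 0 1 1] n_pos by (simp add: mat_unit_component_iff)

lemma one_in_identity_component: "1\<^sub>m n \<in> identity_component"
proof -
  have "hdeg i i 1 = hdeg 0 0 1" if "i < n" for i using hdeg_diag[of i 0 1 1] that n_pos by simp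
  then show ?thesis unfolding component_iff by (simp add: one_in_units)
qed

text \<open>Matrices in this component are diagonal, so a diagonal entry is itself idempotent; if
  nonzero, it is a unit and can be cancelled.\<close>

lemma identity_component_idempotent:
  assumes "X \<in> identity_component" "X * X = X" "i < n"
  shows "X $$ (i, i) = 0 \<or> X $$ (i, i) = 1"
proof -
  have X: "X \<in> carrier_mat n n" using assms(1) by (simp add: component_iff)
  have "X $$ (i, i) = (\<Sum>c<n. X $$ (i, c) * X $$ (c, i))"
    using index_mult_mat_sum[OF X X assms(3,3)] assms(2) by simp
  also have "\<dots> = (\<Sum>c<n. if c = i then X $$ (i, i) * X $$ (i, i) else 0)"
  proof (rule sum.cong[OF refl])
    fix c assume "c \<in> {..<n}"
    then have "X $$ (i, c) = 0" if "c \<noteq> i" using identity_componentD(1)[OF assms(1,3)] that by auto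
    then show "X $$ (i, c) * X $$ (c, i) = (if c = i then X $$ (i, i) * X $$ (i, i) else 0)" by simp
  qed
  finally have "X $$ (i, i) * 1 = X $$ (i, i) * X $$ (i, i)" using assms(3) by simp
  then show ?thesis using identity_componentD(2)[OF assms(1,3,3)] unit_mult_cancel(1) by metis
qed

lemma identity_component_idempotent_nonzero:
  assumes "X \<in> identity_component" "X * X = X" "X \<noteq> 0\<^sub>m n n"
  obtains i where "i < n" "X $$ (i, i) = 1"
proof -
  have "X \<in> carrier_mat n n" using assms(1) by (simp add: component_iff)
  then have "\<exists>i<n. \<exists>j<n. X $$ (i, j) \<noteq> 0"
    using assms(3) by (metis carrier_matD eq_matI index_zero_mat)
  then obtain i j where "i < n" "j < n" "X $$ (i, j) \<noteq> 0" by blast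
  then show ?thesis
    using that identity_componentD(1)[OF assms(1)] identity_component_idempotent[OF assms(1,2)] by metis
qed

end

locale M_equivalence = comm_graded_division_algebra scale G Dc +
  A: M_algebra scale G Dc \<phi> q s d \<delta> + B: M_algebra scale G Dc \<phi>' q' s' d' \<delta>'
  for scale :: "'f::field \<Rightarrow> 'd::ring_1 \<Rightarrow> 'd" and G :: "'g monoid" (structure) and Dc
    and \<phi> q s d \<delta> \<phi>' q' s' d' \<delta>' +
  fixes \<psi> :: "'d mat \<Rightarrow> 'd mat"
  assumes equiv: "graded_inv_equivalence A.R B.R \<psi>"
begin

abbreviation "n \<equiv> q + 2 * s"
abbreviation "n' \<equiv> q' + 2 * s'"
abbreviation "E \<equiv> mat_unit n"
abbreviation "E' \<equiv> mat_unit n'"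

lemma psi_iso: "\<psi> \<in> ring_iso A.R B.R"
  using equiv by (simp add: graded_inv_equivalence_def graded_equivalence_def)

lemma psi_carrier [simp]: "X \<in> carrier_mat n n \<Longrightarrow> \<psi> X \<in> carrier_mat n' n'"
  and psi_mult: "\<lbrakk>X \<in> carrier_mat n n; Y \<in> carrier_mat n n\<rbrakk> \<Longrightarrow> \<psi> (X * Y) = \<psi> X * \<psi> Y"
  and psi_add: "\<lbrakk>X \<in> carrier_mat n n; Y \<in> carrier_mat n n\<rbrakk> \<Longrightarrow> \<psi> (X + Y) = \<psi> X + \<psi> Y"
  and psi_one: "\<psi> (1\<^sub>m n) = 1\<^sub>m n'"
  and psi_bij: "bij_betw \<psi> (carrier_mat n n) (carrier_mat n' n')"
  using psi_iso by (auto simp: ring_iso_def ring_hom_def)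

lemma psi_scale: "X \<in> carrier_mat n n \<Longrightarrow> \<psi> (map_mat (scale a) X) = map_mat (scale a) (\<psi> X)"
  and psi_involution: "X \<in> carrier_mat n n \<Longrightarrow> \<psi> (involution A.R X) = involution B.R (\<psi> X)"
  using equiv by (simp_all add: graded_inv_equivalence_def graded_equivalence_def)

lemma psi_inj: "\<lbrakk>X \<in> carrier_mat n n; Y \<in> carrier_mat n n\<rbrakk> \<Longrightarrow> \<psi> X = \<psi> Y \<longleftrightarrow> X = Y"
  using psi_bij by (auto simp: bij_betw_def inj_on_def)

lemma psi_surj:
  assumes "Y \<in> carrier_mat n' n'"
  obtains X where "X \<in> carrier_mat n n" "\<psi> X = Y"
  using assms psi_bij unfolding bij_betw_def by (metis imageE)

lemma psi_zero: "\<psi> (0\<^sub>m n n) = 0\<^sub>m n' n'"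
proof -
  have c: "\<psi> (0\<^sub>m n n) \<in> carrier_mat n' n'" by simp
  have "\<psi> (0\<^sub>m n n) = \<psi> (0\<^sub>m n n) + \<psi> (0\<^sub>m n n)"
    using psi_add[of "0\<^sub>m n n" "0\<^sub>m n n"] by simp
  then have "\<psi> (0\<^sub>m n n) $$ (i, j) = \<psi> (0\<^sub>m n n) $$ (i, j) + \<psi> (0\<^sub>m n n) $$ (i, j)" if "i < n'" "j < n'" for i j
    using c that by (metis carrier_matD index_add_mat(1))
  then show ?thesis by (intro eq_matI) (simp_all add: carrier_matD[OF c])
qed

lemma psi_component:
  assumes "component A.R \<gamma> \<noteq> {0\<^sub>m n n}" "\<gamma> \<in> carrier (G_tilde T q s (map deg d))"
  obtains \<gamma>' where "\<psi> ` component A.R \<gamma> = component B.R \<gamma>'"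
proof -
  have "\<forall>g\<in>carrier (grading_group A.R). component A.R g \<noteq> {\<zero>\<^bsub>A.R\<^esub>} \<longrightarrow>
      (\<exists>h\<in>carrier (grading_group B.R). \<psi> ` component A.R g = component B.R h)"
    using equiv unfolding graded_inv_equivalence_def graded_equivalence_def by (elim conjE)
  then show ?thesis using assms that by (metis A.R_simps(4,7))
qed

lemma psi_component_mem:
  assumes "\<psi> ` component A.R \<gamma> = component B.R \<gamma>'" "X \<in> carrier_mat n n"
  shows "\<psi> X \<in> component B.R \<gamma>' \<longleftrightarrow> X \<in> component A.R \<gamma>"
  unfolding assms(1)[symmetric] using assms(2) psi_inj by (auto simp: A.component_iff)

text \<open>The image is some component, and it contains the identity matrix, which determines its
  degree.\<close>

lemma psi_identity_component: "\<psi> ` A.identity_component = B.identity_component"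
proof -
  have "A.identity_component \<noteq> {0\<^sub>m n n}"
  proof -
    have "1\<^sub>m n $$ (0, 0) \<noteq> (0\<^sub>m n n :: 'd mat) $$ (0, 0)" using A.n_pos by simp
    then show ?thesis using A.one_in_identity_component by auto
  qed
  then obtain \<gamma> where \<gamma>: "\<psi> ` A.identity_component = component B.R \<gamma>"
    using psi_component A.hdeg_carrier[of 0 0 1] A.n_pos by (metis one_in_units)
  then have "1\<^sub>m n' \<in> component B.R \<gamma>"
    using imageI[OF A.one_in_identity_component, of \<psi>] by (simp only: psi_one)
  then have "B.hdeg 0 0 1 = \<gamma>"
    using B.n_pos unfolding B.component_iff by (metis index_one_mat(1) zero_neq_one)
  then show ?thesis using \<gamma> by simp
qed

lemma E_neq_zero: "i < n \<Longrightarrow> j < n \<Longrightarrow> x \<noteq> 0 \<Longrightarrow> E i j x \<noteq> 0\<^sub>m n n"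
  by (metis index_zero_mat(1) mat_unit_index)

lemma psi_idempotent:
  assumes "i < n"
  shows "\<psi> (E i i 1) \<in> B.identity_component" "\<psi> (E i i 1) * \<psi> (E i i 1) = \<psi> (E i i 1)"
    "\<psi> (E i i 1) \<noteq> 0\<^sub>m n' n'"
proof -
  show "\<psi> (E i i 1) \<in> B.identity_component"
    using psi_identity_component A.mat_unit_in_identity_component[OF assms] by blast
  show "\<psi> (E i i 1) * \<psi> (E i i 1) = \<psi> (E i i 1)"
    using psi_mult[of "E i i 1" "E i i 1"] assms by (simp add: mat_unit_mult_mat_unit)
  show "\<psi> (E i i 1) \<noteq> 0\<^sub>m n' n'"
    using psi_inj[of "E i i 1" "0\<^sub>m n n"] psi_zero E_neq_zero[OF assms assms, of "1::'d"] by simp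
qed

lemma E'_preimage:
  assumes "a < n'"
  obtains X i where "X \<in> A.identity_component" "\<psi> X = E' a a 1" "i < n" "X $$ (i, i) = 1"
proof -
  obtain X where X: "X \<in> carrier_mat n n" "\<psi> X = E' a a 1" by (rule psi_surj[OF mat_unit_carrier])
  have I: "X \<in> A.identity_component"
    using psi_component_mem[OF psi_identity_component X(1)] B.mat_unit_in_identity_component[OF assms] X(2)
    by simp
  have "X * X \<in> carrier_mat n n" using X(1) by simp
  moreover have "\<psi> (X * X) = \<psi> X" using X assms by (simp add: psi_mult mat_unit_mult_mat_unit)
  ultimately have XX: "X * X = X" using psi_inj X(1) by blast
  have "E' a a 1 $$ (a, a) \<noteq> (0\<^sub>m n' n' :: 'd mat) $$ (a, a)" using assms by simp
  then have "X \<noteq> 0\<^sub>m n n" using psi_zero X(2) by metis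
  then obtain i where "i < n" "X $$ (i, i) = 1" by (rule A.identity_component_idempotent_nonzero[OF I XX])
  then show ?thesis using that I X(2) by blast
qed

text \<open>Minimality of the idempotents, made explicit: the image of E_ii has a diagonal entry 1
  at some \<open>a\<close>, so it absorbs E'_aa. Pulled back, E_ii absorbs the preimage X of E'_aa,
  which leaves X no other diagonal entry than the one at \<open>i\<close>.\<close>

lemma psi_E_diag:
  assumes "i < n" obtains a where "a < n'" "\<psi> (E i i 1) = E' a a 1"
proof -
  let ?Y = "\<psi> (E i i 1)"
  obtain a where a: "a < n'" "?Y $$ (a, a) = 1"
    by (rule B.identity_component_idempotent_nonzero[OF psi_idempotent[OF assms]])
  obtain X c where X: "X \<in> A.identity_component" "\<psi> X = E' a a 1" "c < n" "X $$ (c, c) = 1"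
    by (rule E'_preimage[OF a(1)])
  have Xc: "X \<in> carrier_mat n n" using X(1) by (simp add: A.component_iff)
  have "E' a a 1 * ?Y = E' a a 1"
    using B.identity_componentD(1)[OF psi_idempotent(1)[OF assms]] a
    by (intro mat_unit_mult_diagonal) auto
  then have "\<psi> (X * E i i 1) = \<psi> X" using X(2) Xc by (simp add: psi_mult)
  moreover have "X * E i i 1 \<in> carrier_mat n n" using Xc by (rule mult_carrier_mat) simp
  ultimately have XE: "X * E i i 1 = X" using psi_inj Xc by blast
  have "c = i"
    using mult_mat_unit_index[OF Xc assms X(3,3), of i 1] X(4) unfolding XE by (auto split: if_splits)
  then have "X * E i i 1 = E i i 1"
    using A.identity_componentD(1)[OF X(1)] X(3,4) Xc
    by (intro mat_unit_mult_diagonal(2)) auto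
  then show ?thesis using that a(1) X(2) XE by simp
qed

text \<open>If X is the preimage of E'_aa and has entry 1 at \<open>i\<close>, then E_ii X = E_ii
  becomes E'_bb E'_aa = E'_bb under \<open>\<psi>\<close>, so a = b.\<close>

lemma psi_E_diag_surj:
  assumes "a < n'" obtains i where "i < n" "\<psi> (E i i 1) = E' a a 1"
proof -
  obtain X i where X: "X \<in> A.identity_component" "\<psi> X = E' a a 1" "i < n" "X $$ (i, i) = 1"
    by (rule E'_preimage[OF assms])
  have Xc: "X \<in> carrier_mat n n" using X(1) by (simp add: A.component_iff)
  obtain b where b: "b < n'" "\<psi> (E i i 1) = E' b b 1" by (rule psi_E_diag[OF X(3)])
  have "E i i 1 * X = E i i 1"
    using A.identity_componentD(1)[OF X(1)] X(3,4) Xc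
    by (intro mat_unit_mult_diagonal) auto
  then have "E' b b (1::'d) * E' a a 1 = E' b b 1" using b(2) X(2) psi_mult[OF mat_unit_carrier Xc, of i i 1] by metis
  moreover have "(E' b b (1::'d) * E' a a 1) $$ (b, b) = E' a a 1 $$ (b, b)"
    by (simp add: mat_unit_mult_index[OF mat_unit_carrier b(1) b(1) b(1)] del: index_mult_mat(1))
  ultimately have "a = b" using b(1) by (metis mat_unit_index zero_neq_one)
  then show ?thesis using that X(3) b(2) by blast
qed

section \<open>The bijection of indices and the shape of the two algebras\<close>

definition \<pi> :: "nat \<Rightarrow> nat"
  where "\<pi> i = (SOME a. a < n' \<and> \<psi> (E i i 1) = E' a a 1)"

lemma pi_spec:
  assumes "i < n" shows "\<pi> i < n'" "\<psi> (E i i 1) = E' (\<pi> i) (\<pi> i) 1"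
proof -
  have "\<exists>a. a < n' \<and> \<psi> (E i i 1) = E' a a 1" using psi_E_diag[OF assms] by metis
  from someI_ex[OF this] show "\<pi> i < n'" "\<psi> (E i i 1) = E' (\<pi> i) (\<pi> i) 1"
    unfolding \<pi>_def by blast+
qed

lemma mat_unit_diag_eq_iff:
  assumes "a < m" shows "mat_unit m a a (1 :: 'd) = mat_unit m b b 1 \<longleftrightarrow> a = b"
  using assms by (metis mat_unit_index zero_neq_one)

lemma pi_bij: "bij_betw \<pi> {..<n} {..<n'}"
  unfolding bij_betw_def
proof (intro conjI subset_antisym subsetI inj_onI)
  fix i j assume "i \<in> {..<n}" "j \<in> {..<n}" "\<pi> i = \<pi> j"
  then show "i = j"
    using pi_spec psi_inj[of "E i i 1" "E j j 1"] mat_unit_diag_eq_iff[of i n j] by simp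
next
  fix a assume "a \<in> {..<n'}"
  then obtain i where "i < n" "\<psi> (E i i 1) = E' a a 1" using psi_E_diag_surj by auto
  then have "a = \<pi> i" using pi_spec[of i] \<open>a \<in> {..<n'}\<close> mat_unit_diag_eq_iff[of a n' "\<pi> i"] by simp
  then show "a \<in> \<pi> ` {..<n}" using \<open>i < n\<close> by blast
qed (use pi_spec in auto)

text \<open>The involution maps E_ii to the diagonal idempotent at the mate of \<open>i\<close>, as
  its coefficient f_i^{-1} phi(1) f_i is 1.\<close>

lemma pi_mate:
  assumes "i < n" shows "\<pi> (mate q i) = mate q' (\<pi> i)"
proof -
  have m: "mate q i < n" "mate q' (\<pi> i) < n'" using assms pi_spec mate_less by auto
  have "\<psi> (involution A.R (E i i 1)) = E' (\<pi> (mate q i)) (\<pi> (mate q i)) 1"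
    using assms pi_spec(2)[OF m(1)] by (simp add: A.involution_mat_unit)
  moreover have "involution B.R (\<psi> (E i i 1)) = E' (mate q' (\<pi> i)) (mate q' (\<pi> i)) 1"
    using assms pi_spec[OF assms] by (simp add: B.involution_mat_unit)
  ultimately show ?thesis
    using psi_involution[of "E i i 1"] mat_unit_diag_eq_iff[OF m(2)] by simp
qed

lemma shape_eq: "q' = q" "s' = s" and pi_bij_q: "bij_betw \<pi> {..<q} {..<q'}"
proof -
  have iff: "\<pi> i < q' \<longleftrightarrow> i < q" if "i < n" for i
  proof -
    have "\<pi> i < q' \<longleftrightarrow> \<pi> (mate q i) = \<pi> i" using pi_mate[OF that] mate_fixed_iff by metis
    also have "\<dots> \<longleftrightarrow> mate q i = i"
      using pi_bij mate_less[OF that] that by (auto simp: bij_betw_def dest: inj_onD)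
    finally show ?thesis by (simp add: mate_fixed_iff)
  qed
  show b: "bij_betw \<pi> {..<q} {..<q'}"
  proof (rule bij_betw_subset[OF pi_bij])
    show "\<pi> ` {..<q} = {..<q'}"
    proof (intro subset_antisym subsetI)
      fix a assume "a \<in> {..<q'}"
      then have "a \<in> \<pi> ` {..<n}" using pi_bij by (auto simp: bij_betw_def)
      then show "a \<in> \<pi> ` {..<q}" using iff \<open>a \<in> {..<q'}\<close> by auto
    qed (use iff in auto)
  qed auto
  show "q' = q" using bij_betw_same_card[OF b] by simp
  moreover have "n = n'" using bij_betw_same_card[OF pi_bij] by simp
  ultimately show "s' = s" by simp
qed

text \<open>\<open>\<psi>\<close> maps the Peirce space E_ii R E_jj onto the one at (pi i, pi j);
  both are copies of D, and this is the induced map of coefficients.\<close>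

definition \<theta> :: "nat \<Rightarrow> nat \<Rightarrow> 'd \<Rightarrow> 'd"
  where "\<theta> i j x = \<psi> (E i j x) $$ (\<pi> i, \<pi> j)"

lemma psi_sandwich:
  assumes "X \<in> carrier_mat n n" "i < n" "j < n"
  shows "\<psi> (E i j (X $$ (i, j))) = E' (\<pi> i) (\<pi> j) (\<psi> X $$ (\<pi> i, \<pi> j))"
proof -
  have "E i i 1 * X \<in> carrier_mat n n" using mult_carrier_mat[OF mat_unit_carrier assms(1)] .
  then have "\<psi> (E i i 1 * X * E j j 1) = E' (\<pi> i) (\<pi> i) 1 * \<psi> X * E' (\<pi> j) (\<pi> j) 1"
    using assms pi_spec(2) by (simp add: psi_mult)
  then show ?thesis
    using assms pi_spec(1) by (simp add: mat_unit_sandwich)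
qed

lemma psi_E: "\<lbrakk>i < n; j < n\<rbrakk> \<Longrightarrow> \<psi> (E i j x) = E' (\<pi> i) (\<pi> j) (\<theta> i j x)"
  using psi_sandwich[of "E i j x" i j] by (simp add: \<theta>_def)

lemma theta_eqI:
  assumes "i < n" "j < n" "\<psi> (E i j x) = E' (\<pi> i) (\<pi> j) y"
  shows "\<theta> i j x = y"
  using assms pi_spec by (simp add: \<theta>_def)

lemma theta_add: "\<lbrakk>i < n; j < n\<rbrakk> \<Longrightarrow> \<theta> i j (x + y) = \<theta> i j x + \<theta> i j y"
  by (intro theta_eqI) (simp_all add: psi_add psi_E flip: mat_unit_add)

lemma theta_mult:
  assumes "i < n" "j < n" "l < n"
  shows "\<theta> i l (x * y) = \<theta> i j x * \<theta> j l y"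
proof (rule theta_eqI)
  have "\<psi> (E i l (x * y)) = \<psi> (E i j x) * \<psi> (E j l y)"
    using assms by (simp add: mat_unit_mult_mat_unit flip: psi_mult)
  then show "\<psi> (E i l (x * y)) = E' (\<pi> i) (\<pi> l) (\<theta> i j x * \<theta> j l y)"
    using assms pi_spec(1) by (simp only: psi_E mat_unit_mult_mat_unit)
qed (use assms in auto)

lemma theta_one: "i < n \<Longrightarrow> \<theta> i i 1 = 1"
  by (intro theta_eqI) (simp_all add: pi_spec)

lemma map_scale_mat_unit: "map_mat (scale a) (mat_unit m i j x) = mat_unit m i j (scale a x)"
  by (rule eq_matI) (auto simp: mat_unit_def)

lemma theta_scale: "\<lbrakk>i < n; j < n\<rbrakk> \<Longrightarrow> \<theta> i j (scale a x) = scale a (\<theta> i j x)"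
  by (intro theta_eqI) (simp_all add: psi_scale psi_E flip: map_scale_mat_unit)

lemma theta_bij:
  assumes "i < n" "j < n" shows "bij (\<theta> i j)"
proof (rule bijI)
  show "inj (\<theta> i j)"
  proof (rule injI)
    fix x y assume "\<theta> i j x = \<theta> i j y"
    then have "\<psi> (E i j x) = \<psi> (E i j y)" by (simp add: psi_E assms)
    then show "x = y" using psi_inj[OF mat_unit_carrier mat_unit_carrier] mat_unit_eq_iff[OF assms] by metis
  qed
  show "surj (\<theta> i j)"
  proof (intro surjI)
    fix y
    obtain X where "X \<in> carrier_mat n n" "\<psi> X = E' (\<pi> i) (\<pi> j) y" by (rule psi_surj[OF mat_unit_carrier])
    then have "\<theta> i j (X $$ (i, j)) = y"
      using assms pi_spec psi_sandwich[of X i j] by (intro theta_eqI) simp_all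
    then show "\<theta> i j (inv_into UNIV (\<theta> i j) y) = y" by (metis f_inv_into_f rangeI)
  qed
qed

lemma theta_zero_iff: "\<lbrakk>i < n; j < n\<rbrakk> \<Longrightarrow> \<theta> i j x = 0 \<longleftrightarrow> x = 0"
  using theta_add[of i j 0 0] bij_is_inj[OF theta_bij, of i j] by (metis add_cancel_right_right injD add_0)

text \<open>The component containing E_ij x goes onto a component, and at a fixed position equality
  of degrees of matrix units is equality of degrees in D, by \<open>hdeg_inj\<close> on both
  sides.\<close>

lemma theta_unit_deg:
  assumes ij: "i < n" "j < n" and x: "x \<in> U"
  shows "\<theta> i j x \<in> U"
    and "z \<in> U \<and> deg z = deg x \<longleftrightarrow> \<theta> i j z \<in> U \<and> deg (\<theta> i j z) = deg (\<theta> i j x)"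
proof -
  let ?\<gamma> = "A.hdeg i j x"
  have "E i j x \<in> component A.R ?\<gamma>" using ij x by (simp add: A.mat_unit_component_iff)
  moreover have "E i j x \<noteq> 0\<^sub>m n n" using E_neq_zero ij x unit_nonzero by blast
  ultimately obtain \<gamma>' where \<gamma>': "\<psi> ` component A.R ?\<gamma> = component B.R \<gamma>'"
    using psi_component[of ?\<gamma>] A.hdeg_carrier ij x by blast
  have mem: "z = 0 \<or> z \<in> U \<and> A.hdeg i j z = ?\<gamma> \<longleftrightarrow>
      \<theta> i j z = 0 \<or> \<theta> i j z \<in> U \<and> B.hdeg (\<pi> i) (\<pi> j) (\<theta> i j z) = \<gamma>'" for z
    using psi_component_mem[OF \<gamma>', of "E i j z"] ij pi_spec(1)
    by (simp add: psi_E A.mat_unit_component_iff B.mat_unit_component_iff)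
  have tx: "\<theta> i j x \<in> U" "B.hdeg (\<pi> i) (\<pi> j) (\<theta> i j x) = \<gamma>'"
    using mem[of x] x theta_zero_iff[OF ij] unit_nonzero by blast+
  show "\<theta> i j x \<in> U" by (rule tx(1))
  show "z \<in> U \<and> deg z = deg x \<longleftrightarrow> \<theta> i j z \<in> U \<and> deg (\<theta> i j z) = deg (\<theta> i j x)"
    using mem[of z] theta_zero_iff[OF ij, of z] unit_nonzero[of z] unit_nonzero[of "\<theta> i j z"]
      A.hdeg_inj[OF ij, of z x] B.hdeg_inj[of "\<pi> i" "\<pi> j" "\<theta> i j z" "\<theta> i j x"] tx x pi_spec(1) ij
    by blast
qed

lemma theta_automorphism: "graded_automorphism (\<theta> 0 0)"
  unfolding graded_automorphism_def
proof (intro conjI allI ballI impI)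
  note z = A.n_pos
  show "bij (\<theta> 0 0)" by (rule theta_bij[OF z z])
  show "\<theta> 0 0 (x + y) = \<theta> 0 0 x + \<theta> 0 0 y" for x y by (rule theta_add[OF z z])
  show "\<theta> 0 0 (x * y) = \<theta> 0 0 x * \<theta> 0 0 y" for x y by (rule theta_mult[OF z z z])
  show "\<theta> 0 0 1 = 1" by (rule theta_one[OF z])
  show "\<theta> 0 0 (scale a x) = scale a (\<theta> 0 0 x)" for a x by (rule theta_scale[OF z z])
  fix g assume "g \<in> carrier G" "Dc g \<noteq> {0}"
  then obtain x where x: "x \<in> U" "deg x = g" using support_witness by (auto simp: gr_support_def)
  let ?h = "deg (\<theta> 0 0 x)"
  have h: "?h \<in> carrier G"
    using deg_in_support[OF theta_unit_deg(1)[OF z z x(1)]] by (simp add: gr_support_def)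
  have "\<theta> 0 0 ` Dc g = Dc ?h"
  proof -
    have iff: "y \<in> Dc g \<longleftrightarrow> \<theta> 0 0 y \<in> Dc ?h" for y
      using theta_unit_deg(2)[OF z z x(1), of y] theta_zero_iff[OF z z, of y] x(2)
        in_Dc_iff[OF \<open>g \<in> carrier G\<close>] in_Dc_iff[OF h] by blast
    then show ?thesis
      using bij_is_surj[OF theta_bij[OF z z]] by (auto simp: image_iff) (metis surjD)
  qed
  then show "\<exists>h\<in>carrier G. \<theta> 0 0 ` Dc g = Dc h" using h by blast
qed

lemma theta_involution:
  assumes "i < n" "j < n"
  shows "\<theta> (mate q j) (mate q i) (uinv (A.f j) * \<phi> x * A.f i)
    = uinv (B.f (\<pi> j)) * \<phi>' (\<theta> i j x) * B.f (\<pi> i)"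
proof (rule theta_eqI)
  show "mate q j < n" "mate q i < n" using assms mate_less by auto
  show "\<psi> (E (mate q j) (mate q i) (uinv (A.f j) * \<phi> x * A.f i)) =
    E' (\<pi> (mate q j)) (\<pi> (mate q i)) (uinv (B.f (\<pi> j)) * \<phi>' (\<theta> i j x) * B.f (\<pi> i))"
    using psi_involution[of "E i j x"] assms pi_spec(1)
    by (simp add: psi_E pi_mate flip: A.involution_mat_unit B.involution_mat_unit)
qed

text \<open>The coefficient of the image of E_i0. Writing E_ij x as the product of E_i0, E_00 x and
  E_0j then expresses every \<open>\<theta>\<close> through psi_0 and these elements.\<close>

definition p :: "nat \<Rightarrow> 'd" where "p i = \<theta> i 0 1"
abbreviation "\<psi>\<^sub>0 \<equiv> \<theta> 0 0"

lemma p_unit: "i < n \<Longrightarrow> p i \<in> U"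
  unfolding p_def using theta_unit_deg(1)[OF _ A.n_pos one_in_units] .

lemma theta_eq:
  assumes "i < n" "j < n" shows "\<theta> i j x = p i * \<psi>\<^sub>0 x * uinv (p j)"
proof -
  note z = A.n_pos
  have "p j * \<theta> 0 j 1 = 1" "\<theta> 0 j 1 * p j = 1"
    unfolding p_def using theta_mult[OF assms(2) z assms(2), of 1 1] theta_mult[OF z assms(2) z, of 1 1]
      theta_one assms z by simp_all
  then have "uinv (p j) = \<theta> 0 j 1" by (rule uinv_eqI)
  then show ?thesis
    using theta_mult[OF assms(1) z assms(2), of x 1] theta_mult[OF assms(1) z z, of 1 x]
    by (simp add: p_def)
qed

sublocale aut: comm_graded_automorphism scale G Dc \<psi>\<^sub>0
  by unfold_locales (rule theta_automorphism)

definition c\<^sub>0 :: 'd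
  where "c\<^sub>0 = \<phi>' (p 0) * B.f (\<pi> 0) * p (mate q 0) * uinv (\<psi>\<^sub>0 (A.f 0))"

text \<open>Compatibility with the involutions on E_ij x, with \<open>i\<close> and \<open>j\<close>
  moved to different sides. For x = 1 it shows that the expression defining \<open>c\<^sub>0\<close>
  does not depend on the index; for i = j = 0 it becomes condition (i).\<close>

lemma form_twist:
  assumes "i < n" "j < n"
  shows "\<phi>' (p j) * B.f (\<pi> j) * p (mate q j) * uinv (\<psi>\<^sub>0 (A.f j)) * \<psi>\<^sub>0 (\<phi> x)
    = \<phi>' (\<psi>\<^sub>0 x) * (\<phi>' (p i) * B.f (\<pi> i) * p (mate q i) * uinv (\<psi>\<^sub>0 (A.f i)))"
proof -
  have m: "mate q i < n" "mate q j < n" using assms mate_less by auto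
  note u [simp] = p_unit[OF assms(1)] p_unit[OF assms(2)] p_unit[OF m(1)] p_unit[OF m(2)]
  have "\<phi>' (p j) * B.f (\<pi> j) * \<theta> (mate q j) (mate q i) (uinv (A.f j) * \<phi> x * A.f i)
        * p (mate q i) * uinv (\<psi>\<^sub>0 (A.f i))
    = \<phi>' (p j) * B.f (\<pi> j) * p (mate q j) * uinv (\<psi>\<^sub>0 (A.f j)) * \<psi>\<^sub>0 (\<phi> x)"
    unfolding theta_eq[OF m(2,1)] by (simp add: aut.psi_mult aut.psi_uinv mult.assoc)
  moreover have "\<phi>' (p j) * B.f (\<pi> j) * (uinv (B.f (\<pi> j)) * \<phi>' (\<theta> i j x) * B.f (\<pi> i))
        * p (mate q i) * uinv (\<psi>\<^sub>0 (A.f i))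
    = \<phi>' (\<psi>\<^sub>0 x) * (\<phi>' (p i) * B.f (\<pi> i) * p (mate q i) * uinv (\<psi>\<^sub>0 (A.f i)))"
    unfolding theta_eq[OF assms] by (simp add: B.phi_mult B.phi_uinv mult.assoc)
  ultimately show ?thesis using theta_involution[OF assms, of x] by simp
qed

lemma c0_unit: "c\<^sub>0 \<in> U"
  using A.n_pos mate_less[OF A.n_pos] by (simp add: c\<^sub>0_def p_unit)

lemma form_eq_c0:
  assumes "i < n"
  shows "\<phi>' (p i) * B.f (\<pi> i) * p (mate q i) = c\<^sub>0 * \<psi>\<^sub>0 (A.f i)"
proof -
  have c0: "\<phi>' (p i) * B.f (\<pi> i) * p (mate q i) * uinv (\<psi>\<^sub>0 (A.f i)) = c\<^sub>0"
    using form_twist[OF A.n_pos assms, of 1] by (simp add: c\<^sub>0_def)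
  show ?thesis unfolding c0[symmetric] by (simp add: mult.assoc)
qed

lemma twist: "\<phi>' (\<psi>\<^sub>0 x) = c\<^sub>0 * \<psi>\<^sub>0 (\<phi> x) * uinv c\<^sub>0"
  using form_twist[OF A.n_pos A.n_pos, of x, folded c\<^sub>0_def] c0_unit by (simp add: mult.assoc)

text \<open>phi' is applied to c_0 psi_0(f_0) in two ways. Through \<open>form_eq_c0\<close> the
  symmetry of Phi' yields the factor delta'; through \<open>twist\<close> the symmetry of Phi yields
  delta and c_0^{-1} phi'(c_0). The common factor \<open>w\<close> cancels.\<close>

lemma phi'_c0: "\<phi>' c\<^sub>0 = scale (\<delta> * \<delta>') c\<^sub>0"
proof -
  note z = A.n_pos
  have m: "mate q 0 < n" using mate_less[OF z] .
  define w where "w = c\<^sub>0 * \<psi>\<^sub>0 (A.f (mate q 0))"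
  have w: "w \<in> U" using c0_unit by (simp add: w_def)
  have "\<phi>' (c\<^sub>0 * \<psi>\<^sub>0 (A.f 0)) = \<phi>' (p (mate q 0)) * (B.eps * B.f (\<pi> (mate q 0))) * p 0"
    unfolding form_eq_c0[OF z, symmetric]
    by (simp add: B.phi_mult B.phi_f pi_mate[OF z] mult.assoc)
  also have "\<dots> = B.eps * (\<phi>' (p (mate q 0)) * B.f (\<pi> (mate q 0)) * p (mate q (mate q 0)))"
    using B.eps_commute[of "\<phi>' (p (mate q 0))"] by (simp flip: mult.assoc)
  also have "\<dots> = B.eps * w" unfolding form_eq_c0[OF m] w_def by simp
  finally have 1: "\<phi>' (c\<^sub>0 * \<psi>\<^sub>0 (A.f 0)) = B.eps * w" .
  have eps: "\<psi>\<^sub>0 A.eps = A.eps" by (simp add: A.eps_def aut.psi_scale)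
  have "\<phi>' (c\<^sub>0 * \<psi>\<^sub>0 (A.f 0)) = c\<^sub>0 * A.eps * \<psi>\<^sub>0 (A.f (mate q 0)) * uinv c\<^sub>0 * \<phi>' c\<^sub>0"
    by (simp add: B.phi_mult twist A.phi_f aut.psi_mult eps mult.assoc)
  also have "\<dots> = A.eps * w * uinv c\<^sub>0 * \<phi>' c\<^sub>0"
    unfolding A.eps_commute[of c\<^sub>0] w_def by (simp add: mult.assoc)
  finally have "w * (A.eps * B.eps) = w * (uinv c\<^sub>0 * \<phi>' c\<^sub>0)"
    unfolding 1 using A.eps_commute[of w] B.eps_commute[of "w"] B.eps_commute A.eps_eps(2)
    by (metis mult.assoc)
  then have "A.eps * B.eps = uinv c\<^sub>0 * \<phi>' c\<^sub>0" using unit_mult_cancel(1)[OF w] by blast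
  then have "\<phi>' c\<^sub>0 = c\<^sub>0 * (A.eps * B.eps)" using c0_unit by simp
  also have "\<dots> = A.eps * (B.eps * c\<^sub>0)"
    using A.eps_commute B.eps_commute by (metis mult.assoc)
  also have "\<dots> = scale (\<delta> * \<delta>') c\<^sub>0" by (simp flip: A.scale_delta B.scale_delta)
  finally show ?thesis .
qed

lemma obtain_data:
  obtains c where "length c = q" "set c \<subseteq> U"
    "mset d' = mset (map (\<lambda>i. c\<^sub>0 * \<psi>\<^sub>0 (c ! i * d ! i * \<phi> (c ! i))) [0..<q])"
proof
  define r where "r i = inv_into UNIV \<psi>\<^sub>0 (p i)" for i
  have pr: "\<psi>\<^sub>0 (r i) = p i" for i
    unfolding r_def using bij_is_surj[OF aut.bij_psi] by (simp add: surj_f_inv_f)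
  have rU: "r i \<in> U" if "i < n" for i
    using aut.psi_unit_preimage[OF p_unit[OF that]] pr bij_is_inj[OF aut.bij_psi] by (metis injD)
  \<comment> \<open>With p_i = psi_0(r_i), solving the form equation for d' gives c_0
    psi_0(phi(r_i)^{-1} d_i r_i^{-1}), and r_i^{-1} is phi applied to phi(r_i)^{-1}.\<close>
  define c where "c = map (\<lambda>i. uinv (\<phi> (r i))) [0..<q]"
  show "length c = q" by (simp add: c_def)
  show "set c \<subseteq> U" by (auto simp: c_def rU)
  have "d' ! \<pi> i = c\<^sub>0 * \<psi>\<^sub>0 (c ! i * d ! i * \<phi> (c ! i))" if "i < q" for i
  proof -
    have i: "i < n" using that by simp
    note [simp] = rU[OF i] c0_unit p_unit[OF i]
    have "\<pi> i < q'" using pi_bij_q that by (auto simp: bij_betw_def)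
    then have f: "B.f (\<pi> i) = d' ! \<pi> i" "A.f i = d ! i" "mate q i = i"
      using that by (simp_all add: A.f_def B.f_def phi_coeff_def A.length_d B.length_d mate_fixed_iff)
    have "\<phi>' (p i) = c\<^sub>0 * \<psi>\<^sub>0 (\<phi> (r i)) * uinv c\<^sub>0" using twist[of "r i"] by (simp add: pr)
    then have "c\<^sub>0 * \<psi>\<^sub>0 (\<phi> (r i)) * uinv c\<^sub>0 * d' ! \<pi> i * p i = c\<^sub>0 * \<psi>\<^sub>0 (d ! i)"
      using form_eq_c0[OF i] f by simp
    then have "c\<^sub>0 * uinv (\<psi>\<^sub>0 (\<phi> (r i))) * uinv c\<^sub>0 * (c\<^sub>0 * \<psi>\<^sub>0 (\<phi> (r i)) * uinv c\<^sub>0 * d' ! \<pi> i * p i) * uinv (p i)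
       = c\<^sub>0 * uinv (\<psi>\<^sub>0 (\<phi> (r i))) * uinv c\<^sub>0 * (c\<^sub>0 * \<psi>\<^sub>0 (d ! i)) * uinv (p i)" by simp
    then have "d' ! \<pi> i = c\<^sub>0 * uinv (\<psi>\<^sub>0 (\<phi> (r i))) * \<psi>\<^sub>0 (d ! i) * uinv (p i)"
      by (simp add: mult.assoc)
    then show ?thesis
      using that by (simp add: c_def aut.psi_mult aut.psi_uinv A.phi_uinv pr mult.assoc)
  qed
  then have "mset (map (\<lambda>i. c\<^sub>0 * \<psi>\<^sub>0 (c ! i * d ! i * \<phi> (c ! i))) [0..<q]) = mset (map (\<lambda>i. d' ! \<pi> i) [0..<q])"
    by (intro arg_cong[of _ _ mset] map_cong) auto
  also have "\<dots> = image_mset ((!) d') (image_mset \<pi> (mset_set {..<q}))"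
    by (simp add: multiset.map_comp comp_def atLeast0LessThan)
  also have "image_mset \<pi> (mset_set {..<q}) = mset_set {..<q'}"
    using pi_bij_q by (metis bij_betw_def image_mset_mset_set)
  also have "image_mset ((!) d') (mset_set {..<q'}) = mset (map ((!) d') [0..<length d'])"
    by (simp add: B.length_d atLeast0LessThan)
  also have "\<dots> = mset d'" by (simp add: map_nth)
  finally show "mset d' = mset (map (\<lambda>i. c\<^sub>0 * \<psi>\<^sub>0 (c ! i * d ! i * \<phi> (c ! i))) [0..<q])" by simp
qed

lemma phi'_eq: "\<phi>' = Int_aut (alg_of scale G Dc) c\<^sub>0 \<circ> (\<psi>\<^sub>0 \<circ> \<phi> \<circ> inv_into UNIV \<psi>\<^sub>0)"
proof
  fix y
  have "\<psi>\<^sub>0 (inv_into UNIV \<psi>\<^sub>0 y) = y"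
    using bij_is_surj[OF aut.bij_psi] by (simp add: surj_f_inv_f)
  then show "\<phi>' y = (Int_aut (alg_of scale G Dc) c\<^sub>0 \<circ> (\<psi>\<^sub>0 \<circ> \<phi> \<circ> inv_into UNIV \<psi>\<^sub>0)) y"
    using twist[of "inv_into UNIV \<psi>\<^sub>0 y"] by (simp add: Int_aut_unit[OF c0_unit])
qed

end

section \<open>The criterion for equivalence, with permutations of tuples expressed by
  multisets\<close>

theorem theorem5p5:
  fixes scale :: "'f::field \<Rightarrow> 'd::ring_1 \<Rightarrow> 'd"
    and G :: "'g monoid"
    and Dc :: "'g \<Rightarrow> 'd set"
    and \<phi>\<^sub>0 \<phi>\<^sub>0' :: "'d \<Rightarrow> 'd"
    and q s q' s' :: nat
    and d d' :: "'d list"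
    and \<delta> \<delta>' :: 'f
  assumes "graded_division_algebra scale G Dc"
    and "\<forall>g\<in>gr_support G Dc. \<forall>h\<in>gr_support G Dc. g \<otimes>\<^bsub>G\<^esub> h = h \<otimes>\<^bsub>G\<^esub> g"
    and "M_data scale G Dc \<phi>\<^sub>0 q s d \<delta>"
    and "M_data scale G Dc \<phi>\<^sub>0' q' s' d' \<delta>'"
  shows "graded_inv_equivalent
           (M_alg scale G Dc \<phi>\<^sub>0 q s d \<delta>) (M_alg scale G Dc \<phi>\<^sub>0' q' s' d' \<delta>') \<longleftrightarrow>
         q' = q \<and> s' = s \<and>
         (\<exists>\<psi>\<^sub>0 c\<^sub>0.
            graded_equivalence (alg_of scale G Dc) (alg_of scale G Dc) \<psi>\<^sub>0 \<and>
            c\<^sub>0 \<in> gr_units G Dc \<and>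
            \<phi>\<^sub>0' = Int_aut (alg_of scale G Dc) c\<^sub>0 \<circ> (\<psi>\<^sub>0 \<circ> \<phi>\<^sub>0 \<circ> inv_into UNIV \<psi>\<^sub>0) \<and>
            \<phi>\<^sub>0' c\<^sub>0 = scale (\<delta> * \<delta>') c\<^sub>0 \<and>
            (\<exists>c. length c = q \<and> set c \<subseteq> gr_units G Dc \<and>
               mset d' = mset (map (\<lambda>i. c\<^sub>0 * \<psi>\<^sub>0 (c ! i * d ! i * \<phi>\<^sub>0 (c ! i))) [0..<q])))"
proof -
  interpret comm_graded_division_algebra scale G Dc
    using assms(1,2) by (simp add: comm_graded_division_algebra_def comm_graded_division_algebra_axioms_def)
  interpret A: M_algebra scale G Dc \<phi>\<^sub>0 q s d \<delta> by unfold_locales (rule assms(3))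
  interpret B: M_algebra scale G Dc \<phi>\<^sub>0' q' s' d' \<delta>' by unfold_locales (rule assms(4))
  show ?thesis (is "?L \<longleftrightarrow> ?R")
  proof
    assume ?L
    then obtain \<psi> where "graded_inv_equivalence A.R B.R \<psi>" by (auto simp: graded_inv_equivalent_def)
    then interpret E: M_equivalence scale G Dc \<phi>\<^sub>0 q s d \<delta> \<phi>\<^sub>0' q' s' d' \<delta>' \<psi> by unfold_locales
    obtain c where c: "length c = q" "set c \<subseteq> U"
      "mset d' = mset (map (\<lambda>i. E.c\<^sub>0 * E.\<psi>\<^sub>0 (c ! i * d ! i * \<phi>\<^sub>0 (c ! i))) [0..<q])"
      by (rule E.obtain_data)
    show ?R
      unfolding graded_equivalence_iff
      by (intro conjI exI[of _ E.\<psi>\<^sub>0] exI[of _ E.c\<^sub>0] exI[of _ c] c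
          E.shape_eq E.theta_automorphism E.c0_unit E.phi'_eq E.phi'_c0)
  next
    assume R: ?R
    then have [simp]: "q' = q" "s' = s" by auto
    \<comment> \<open>The criterion provides equal shapes, so both algebras can be indexed by the
      same \<open>q\<close> and \<open>s\<close>.\<close>
    interpret S: M_same_shape scale G Dc \<phi>\<^sub>0 q s d \<delta> \<phi>\<^sub>0' d' \<delta>'
      using B.M_algebra_axioms A.M_algebra_axioms by (simp add: M_same_shape_def comm_graded_division_algebra_axioms)
    from R show ?L
      using S.graded_inv_equivalentI unfolding graded_equivalence_iff by (elim conjE exE) simp
  qed
qed

end
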